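(* Consider a finite-space SSP game (as in the context) satisfying the Finite-Space SSP Game Model Assumption, and the Q-learning algorithm described in the context, and suppose algorithmic conditions (i)–(v) hold. Then for any given initial $Q_0$, the sequence $\{Q_t\}$ generated by the Q-learning algorithm converges with probability 1 to the unique solution $Q^*$ of the equation $Q=FQ$.
   Context: Finite-space game: $S=\{1,\dots,n\}$, $S_o=S\cup\{0\}$, $0$ absorbing cost-free termination state. At $i\in S$, players I and II have finite control sets $U(i),V(i)$; under $(u,v)$ the state moves to $j\in S_o$ w.p. $p_{ij}(u,v)$ with (deterministic, real) transition cost $\hat g(i,u,v,j)$ paid by player I to player II; $g(i,u,v)$ is the expected one-stage cost. $J(i;\pi_1,\pi_2)=\liminf_{t\to\infty}E_{\pi_1\pi_2}[\sum_{k=0}^t\hat g(i_k,u_k,v_k,i_{k+1})\mid i_0=i]$ for history-dependent randomized policies. $\bar U(i)=\mathcal P(U(i))$, $\bar V(i)=\mathcal P(V(i))$; $\Pi_{1,SR},\Pi_{2,SR}$: stationary randomized policies. A pair of policies is prolonging if for some initial state the termination state is with positive probability never reached. Finite-Space SSP Game Model Assumption: (i) there is $\bar\mu\in\Pi_{1,SR}$ with $J(i;\bar\mu,\nu)<+\infty$ for all $\nu\in\Pi_{2,SR}$, all $i$; (ii) there is $\bar\nu\in\Pi_{2,SR}$ with $J(i;\mu,\bar\nu)>-\infty$ for all $\mu\in\Pi_{1,SR}$, all $i$; (iii) every prolonging pair in $\Pi_{1,SR}\times\Pi_{2,SR}$ has $J(i;\mu,\nu)\in\{+\infty,-\infty\}$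 for some $i$. $R=\{(i,u,v):i\in S,u\in U(i),v\in V(i)\}$; $U(0)=V(0)=\{0\}$, Q-factor vectors indexed by $R\cup\{(0,0,0)\}$ with $Q(0,0,0)=0$. $\underline Q(s,\rho,\sigma)=\sum_{\tilde u,\tilde v}\rho(\tilde u)\sigma(\tilde v)Q(s,\tilde u,\tilde v)$. $F$: $(FQ)(i,u,v)=g(i,u,v)+\sum_{j\in S}p_{ij}(u,v)\inf_{\rho\in\bar U(j)}\sup_{\sigma\in\bar V(j)}\underline Q(j,\rho,\sigma)$. Q-learning: on $(\Omega,\mathcal F,\mathbf P)$ with filtration $\{\mathcal F_t\}$; for each $t$ and $\ell=(i,u,v)\in R$, stepsize $\gamma_{t,\ell}\in[0,1]$, delays $0\le\tau_{\ell\tilde\ell}(t)\le t$, successor $j_t^\ell\in S_o$; with $Q_t^{(\ell)}(\tilde\ell)=Q_{\tau_{\ell\tilde\ell}(t)}(\tilde\ell)$ and $s=j_t^\ell$: $Q_{t+1}(i,u,v)=(1-\gamma_{t,\ell})Q_t(i,u,v)+\gamma_{t,\ell}\big(\hat g(i,u,v,s)+\inf_{\rho\in\bar U(s)}\sup_{\sigma\in\bar V(s)}\underline Q^{(\ell)}_t(s,\rho,\sigma)\big)$. Algorithmic conditions: (i) $Q_0$ is $\mathcal F_0$-measurable; (ii) $\gamma_{t,\ell},\tau_{\ell\tilde\ell}(t)$ are $\mathcal F_t$-measurable; (iii) $j_t^\ell$ is $\mathcal F_{t+1}$-measurable with $\mathbf P(j_t^\ell=j\mid\mathcal F_t)=p_{ij}(u,v)$;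 (iv) w.p.1 $\tau_{\ell\tilde\ell}(t)\to\infty$ for all $\ell,\tilde\ell$; (v) w.p.1 $\sum_t\gamma_{t,\ell}=\infty$, $\sum_t\gamma_{t,\ell}^2<\infty$ for all $\ell$. *)

theory Defs
  imports "HOL-Probability.Probability"
begin

text \<open>States: S = {1..n}, termination state 0. Controls U i, V i.
  Transitions: P i u v is a distribution on {0..n}; p_ij(u,v) = pmf (P i u v) j.
  Transition costs ghat i u v j (paid by player I to player II).\<close>

definition finite_ssp_game ::
  "nat \<Rightarrow> (nat \<Rightarrow> 'u set) \<Rightarrow> (nat \<Rightarrow> 'v set) \<Rightarrow> (nat \<Rightarrow> 'u \<Rightarrow> 'v \<Rightarrow> nat pmf) \<Rightarrow> bool" where
  "finite_ssp_game n U V P \<longleftrightarrow>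
     (\<forall>i\<in>{1..n}. finite (U i) \<and> U i \<noteq> {} \<and> finite (V i) \<and> V i \<noteq> {}) \<and>
     (\<forall>i\<in>{1..n}. \<forall>u\<in>U i. \<forall>v\<in>V i. set_pmf (P i u v) \<subseteq> {0..n})"

definition gcost ::
  "nat \<Rightarrow> (nat \<Rightarrow> 'u \<Rightarrow> 'v \<Rightarrow> nat pmf) \<Rightarrow> (nat \<Rightarrow> 'u \<Rightarrow> 'v \<Rightarrow> nat \<Rightarrow> real) \<Rightarrow> nat \<Rightarrow> 'u \<Rightarrow> 'v \<Rightarrow> real" where
  "gcost n P ghat i u v = (\<Sum>j\<in>{0..n}. pmf (P i u v) j * ghat i u v j)"

definition SR1 :: "nat \<Rightarrow> (nat \<Rightarrow> 'u set) \<Rightarrow> (nat \<Rightarrow> 'u pmf) set" where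
  "SR1 n U = {\<mu>. \<forall>i\<in>{1..n}. set_pmf (\<mu> i) \<subseteq> U i}"

definition SR2 :: "nat \<Rightarrow> (nat \<Rightarrow> 'v set) \<Rightarrow> (nat \<Rightarrow> 'v pmf) set" where
  "SR2 n V = {\<nu>. \<forall>i\<in>{1..n}. set_pmf (\<nu> i) \<subseteq> V i}"

definition sr_step ::
  "(nat \<Rightarrow> 'u \<Rightarrow> 'v \<Rightarrow> nat pmf) \<Rightarrow> (nat \<Rightarrow> 'u pmf) \<Rightarrow> (nat \<Rightarrow> 'v pmf) \<Rightarrow> nat \<Rightarrow> nat pmf" where
  "sr_step P \<mu> \<nu> j =
     (if j = 0 then return_pmf 0
      else bind_pmf (\<mu> j) (\<lambda>u. bind_pmf (\<nu> j) (\<lambda>v. P j u v)))"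

definition sr_state_dist ::
  "(nat \<Rightarrow> 'u \<Rightarrow> 'v \<Rightarrow> nat pmf) \<Rightarrow> (nat \<Rightarrow> 'u pmf) \<Rightarrow> (nat \<Rightarrow> 'v pmf) \<Rightarrow> nat \<Rightarrow> nat \<Rightarrow> nat pmf" where
  "sr_state_dist P \<mu> \<nu> i k = ((\<lambda>d. bind_pmf d (sr_step P \<mu> \<nu>)) ^^ k) (return_pmf i)"

definition sr_stage_cost ::
  "(nat \<Rightarrow> 'u \<Rightarrow> 'v \<Rightarrow> nat pmf) \<Rightarrow> (nat \<Rightarrow> 'u \<Rightarrow> 'v \<Rightarrow> nat \<Rightarrow> real) \<Rightarrow>
   (nat \<Rightarrow> 'u pmf) \<Rightarrow> (nat \<Rightarrow> 'v pmf) \<Rightarrow> nat \<Rightarrow> real" where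
  "sr_stage_cost P ghat \<mu> \<nu> j =
     (if j = 0 then 0
      else measure_pmf.expectation
             (bind_pmf (\<mu> j) (\<lambda>u. bind_pmf (\<nu> j) (\<lambda>v.
                bind_pmf (P j u v) (\<lambda>j'. return_pmf (u, v, j')))))
             (\<lambda>(u, v, j'). ghat j u v j'))"

definition Jcost ::
  "(nat \<Rightarrow> 'u \<Rightarrow> 'v \<Rightarrow> nat pmf) \<Rightarrow> (nat \<Rightarrow> 'u \<Rightarrow> 'v \<Rightarrow> nat \<Rightarrow> real) \<Rightarrow>
   nat \<Rightarrow> (nat \<Rightarrow> 'u pmf) \<Rightarrow> (nat \<Rightarrow> 'v pmf) \<Rightarrow> ereal" where
  "Jcost P ghat i \<mu> \<nu> =
     liminf (\<lambda>t. ereal (\<Sum>k\<le>t. measure_pmf.expectation (sr_state_dist P \<mu> \<nu> i k)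
                                     (sr_stage_cost P ghat \<mu> \<nu>)))"

text \<open>Prolonging pair: for some initial state, the probability of never reaching 0,
  i.e. lim_k P(i_k \<noteq> 0) (0 is absorbing), is positive.\<close>
definition prolonging ::
  "nat \<Rightarrow> (nat \<Rightarrow> 'u \<Rightarrow> 'v \<Rightarrow> nat pmf) \<Rightarrow> (nat \<Rightarrow> 'u pmf) \<Rightarrow> (nat \<Rightarrow> 'v pmf) \<Rightarrow> bool" where
  "prolonging n P \<mu> \<nu> \<longleftrightarrow>
     (\<exists>i\<in>{1..n}. (INF k. measure_pmf.prob (sr_state_dist P \<mu> \<nu> i k) {j. j \<noteq> 0}) > 0)"

definition ssp_game_assumption ::
  "nat \<Rightarrow> (nat \<Rightarrow> 'u set) \<Rightarrow> (nat \<Rightarrow> 'v set) \<Rightarrow> (nat \<Rightarrow> 'u \<Rightarrow> 'v \<Rightarrow> nat pmf) \<Rightarrow>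
   (nat \<Rightarrow> 'u \<Rightarrow> 'v \<Rightarrow> nat \<Rightarrow> real) \<Rightarrow> bool" where
  "ssp_game_assumption n U V P ghat \<longleftrightarrow>
     (\<exists>\<mu>b\<in>SR1 n U. \<forall>\<nu>\<in>SR2 n V. \<forall>i\<in>{1..n}. Jcost P ghat i \<mu>b \<nu> < \<infinity>) \<and>
     (\<exists>\<nu>b\<in>SR2 n V. \<forall>\<mu>\<in>SR1 n U. \<forall>i\<in>{1..n}. Jcost P ghat i \<mu> \<nu>b > -\<infinity>) \<and>
     (\<forall>\<mu>\<in>SR1 n U. \<forall>\<nu>\<in>SR2 n V. prolonging n P \<mu> \<nu> \<longrightarrow>
        (\<exists>i\<in>{1..n}. Jcost P ghat i \<mu> \<nu> \<in> {\<infinity>, -\<infinity>}))"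

definition Rset :: "nat \<Rightarrow> (nat \<Rightarrow> 'u set) \<Rightarrow> (nat \<Rightarrow> 'v set) \<Rightarrow> (nat \<times> 'u \<times> 'v) set" where
  "Rset n U V = {(i, u, v). i \<in> {1..n} \<and> u \<in> U i \<and> v \<in> V i}"

definition Qbar ::
  "(nat \<Rightarrow> 'u set) \<Rightarrow> (nat \<Rightarrow> 'v set) \<Rightarrow> (nat \<times> 'u \<times> 'v \<Rightarrow> real) \<Rightarrow> nat \<Rightarrow> 'u pmf \<Rightarrow> 'v pmf \<Rightarrow> real" where
  "Qbar U V Q s \<rho> \<sigma> = (\<Sum>u\<in>U s. \<Sum>v\<in>V s. pmf \<rho> u * pmf \<sigma> v * Q (s, u, v))"

text \<open>inf_{rho in Ubar(s)} sup_{sigma in Vbar(s)} Qbar(s,rho,sigma); equal to Q(0,0,0) = 0 at s = 0.\<close>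
definition minmax_val ::
  "(nat \<Rightarrow> 'u set) \<Rightarrow> (nat \<Rightarrow> 'v set) \<Rightarrow> (nat \<times> 'u \<times> 'v \<Rightarrow> real) \<Rightarrow> nat \<Rightarrow> real" where
  "minmax_val U V Q s =
     (if s = 0 then 0
      else (INF \<rho>\<in>{\<rho>. set_pmf \<rho> \<subseteq> U s}. SUP \<sigma>\<in>{\<sigma>. set_pmf \<sigma> \<subseteq> V s}. Qbar U V Q s \<rho> \<sigma>))"

definition Fop ::
  "nat \<Rightarrow> (nat \<Rightarrow> 'u set) \<Rightarrow> (nat \<Rightarrow> 'v set) \<Rightarrow> (nat \<Rightarrow> 'u \<Rightarrow> 'v \<Rightarrow> nat pmf) \<Rightarrow>
   (nat \<Rightarrow> 'u \<Rightarrow> 'v \<Rightarrow> nat \<Rightarrow> real) \<Rightarrow> (nat \<times> 'u \<times> 'v \<Rightarrow> real) \<Rightarrow> (nat \<times> 'u \<times> 'v \<Rightarrow> real)" where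
  "Fop n U V P ghat Q = (\<lambda>(i, u, v).
     gcost n P ghat i u v + (\<Sum>j\<in>{1..n}. pmf (P i u v) j * minmax_val U V Q j))"

definition is_fixpoint_F ::
  "nat \<Rightarrow> (nat \<Rightarrow> 'u set) \<Rightarrow> (nat \<Rightarrow> 'v set) \<Rightarrow> (nat \<Rightarrow> 'u \<Rightarrow> 'v \<Rightarrow> nat pmf) \<Rightarrow>
   (nat \<Rightarrow> 'u \<Rightarrow> 'v \<Rightarrow> nat \<Rightarrow> real) \<Rightarrow> (nat \<times> 'u \<times> 'v \<Rightarrow> real) \<Rightarrow> bool" where
  "is_fixpoint_F n U V P ghat Q \<longleftrightarrow> (\<forall>l\<in>Rset n U V. Fop n U V P ghat Q l = Q l)"

end

theory Submission
  imports Defs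
begin

text \<open>
  Write \<open>F\<close> for the Q-factor operator. Three observations carry the proof.

  Comparison: if a pair of stationary policies has a subsolution and a supersolution of its evaluation
  equation, its partial costs are bounded, so by (iii) it is not prolonging, and then the subsolution lies
  below the supersolution. Pairing a minimizing strategy for \<open>X\<close> with a best response for \<open>Y\<close> extends this
  to \<open>F X \<le> X\<close> and \<open>Y \<le> F Y\<close>, hence \<open>Y \<le> X\<close>.

  Strict solutions: against the policy of (i), player II faces a Markov decision problem whose subsolutions
  are bounded above. If the problem with costs increased by \<open>\<epsilon>\<close> had no solution for any \<open>\<epsilon> > 0\<close>, truncating it
  slightly above the greatest subsolution and letting \<open>\<epsilon>\<close> tend to 0 would give a larger subsolution.
  So \<open>F Z < Z\<close> has a solution, and by symmetry so has \<open>Z < F Z\<close>.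

  Sample paths: almost surely the stepsize-weighted empirical successor distributions converge to the
  transition probabilities (square-summable martingale differences). Unrolled, an iterate is an average of
  sampled updates with these weights, so \<open>F Z < Z\<close> bounds the iterates from above, and their limit superior
  \<open>u\<close> satisfies \<open>u \<le> F u\<close>; dually for the limit inferior. Comparison makes the two limits equal.
\<close>

subsection \<open>Stochastic averaging\<close>

text \<open>Once \<open>e\<close> stays below \<open>r / 2\<close> in absolute value, the excess of
  the absolute value of \<open>D\<close> over \<open>r / 2\<close> is at most 1 - \<gamma> \<le>
  exp(-\<gamma>) times a nonnegative bound on the previous excess. The stepsizes have infinite sum,
  so the resulting exponential tends to 0.\<close>

lemma averaging_tendsto_zero:
  fixes \<gamma> e D :: "nat \<Rightarrow> real"
  assumes range: "\<And>t. 0 \<le> \<gamma> t \<and> \<gamma> t \<le> 1"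
    and div: "filterlim (\<lambda>T. \<Sum>t<T. \<gamma> t) at_top sequentially"
    and e: "e \<longlonglongrightarrow> 0"
    and rec: "\<And>t. t \<ge> T \<Longrightarrow> D (Suc t) = (1 - \<gamma> t) * D t + \<gamma> t * e t"
  shows "D \<longlonglongrightarrow> 0"
proof (rule LIMSEQ_I)
  fix r :: real assume "r > 0"
  then obtain N where N: "\<And>t. t \<ge> N \<Longrightarrow> \<bar>e t\<bar> < r / 2"
    using LIMSEQ_D[OF e, of "r/2"] by auto
  define m where "m = max N T"
  define S where "S t = (\<Sum>k<t. \<gamma> k)" for t
  have step: "\<bar>D (m + k)\<bar> - r/2 \<le> exp (S m - S (m + k)) * \<bar>D m\<bar>" for k
  proof (induction k)
    case 0
    then show ?case using \<open>r > 0\<close> by simp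
  next
    case (Suc k)
    let ?g = "\<gamma> (m + k)"
    have "\<bar>D (m + Suc k)\<bar> \<le> (1 - ?g) * \<bar>D (m + k)\<bar> + ?g * \<bar>e (m + k)\<bar>"
      using rec[of "m + k"] range[of "m + k"] abs_triangle_ineq[of "(1 - ?g) * D (m + k)" "?g * e (m + k)"]
      unfolding abs_mult by (simp add: m_def le_max_iff_disj trans_le_add1)
    also have "\<dots> \<le> (1 - ?g) * \<bar>D (m + k)\<bar> + ?g * (r / 2)"
      using N[of "m + k"] range[of "m + k"]
      by (intro add_left_mono mult_left_mono) (auto simp: m_def le_max_iff_disj trans_le_add1 intro: less_imp_le)
    finally have "\<bar>D (m + Suc k)\<bar> - r/2 \<le> (1 - ?g) * (\<bar>D (m + k)\<bar> - r / 2)"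
      by (simp add: algebra_simps)
    also have "\<dots> \<le> (1 - ?g) * (exp (S m - S (m + k)) * \<bar>D m\<bar>)"
      using Suc range[of "m + k"] by (intro mult_left_mono) auto
    also have "\<dots> \<le> exp (- ?g) * (exp (S m - S (m + k)) * \<bar>D m\<bar>)"
      using exp_ge_add_one_self[of "- ?g"] by (intro mult_right_mono) auto
    also have "\<dots> = exp (S m - S (m + Suc k)) * \<bar>D m\<bar>"
      by (simp add: S_def flip: exp_add mult.assoc)
    finally show ?case .
  qed
  have "filterlim (\<lambda>k. S (k + m)) at_top sequentially"
    using div unfolding S_def[symmetric] by (rule filterlim_compose) (rule filterlim_add_const_nat_at_top)
  then have "filterlim (\<lambda>k. S m - S (k + m)) at_bot sequentially"
    using filterlim_tendsto_add_at_top[OF tendsto_const, of "\<lambda>k. S (k + m)" sequentially "- S m"]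
    by (simp add: filterlim_uminus_at_top)
  then have "(\<lambda>k. exp (S m - S (k + m)) * \<bar>D m\<bar>) \<longlonglongrightarrow> 0 * \<bar>D m\<bar>"
    by (intro tendsto_mult tendsto_const filterlim_compose[OF exp_at_bot])
  from LIMSEQ_D[OF this, of "r/2"] \<open>r > 0\<close>
  obtain k0 where k0: "\<And>k. k \<ge> k0 \<Longrightarrow> exp (S m - S (k + m)) * \<bar>D m\<bar> < r / 2"
    by (auto simp: abs_mult)
  show "\<exists>no. \<forall>n\<ge>no. norm (D n - 0) < r"
  proof (intro exI allI impI)
    fix n assume "n \<ge> k0 + m"
    then obtain k where k: "n = m + k" "k \<ge> k0"
      by (metis add.commute le_add_diff_inverse le_diff_conv2 add_leE)
    show "norm (D n - 0) < r"
      using step[of k] k0[OF k(2)] k(1) by (simp add: add.commute)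
  qed
qed

text \<open>Let \<open>e\<close> be the partial sums minus their limit. Then \<open>D - e\<close>
  satisfies an averaging recursion driven by \<open>- e\<close>, which tends to 0. This handles
  noise that does not itself tend to 0.\<close>

lemma averaging_tendsto_zero_series:
  fixes \<gamma> \<xi> D :: "nat \<Rightarrow> real"
  assumes range: "\<And>t. 0 \<le> \<gamma> t \<and> \<gamma> t \<le> 1"
    and div: "filterlim (\<lambda>T. \<Sum>t<T. \<gamma> t) at_top sequentially"
    and conv: "convergent (\<lambda>n. \<Sum>k<n. \<gamma> k * \<xi> k)"
    and rec: "\<And>t. t \<ge> T \<Longrightarrow> D (Suc t) = (1 - \<gamma> t) * D t + \<gamma> t * \<xi> t"
  shows "D \<longlonglongrightarrow> 0"
proof -
  obtain L where L: "(\<lambda>n. \<Sum>k<n. \<gamma> k * \<xi> k) \<longlonglongrightarrow> L"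
    using conv by (auto simp: convergent_def)
  define e where "e n = (\<Sum>k<n. \<gamma> k * \<xi> k) - L" for n
  have e: "e \<longlonglongrightarrow> 0"
    unfolding e_def using tendsto_diff[OF L tendsto_const[of L]] by simp
  have "(\<lambda>t. D t - e t) \<longlonglongrightarrow> 0"
  proof (rule averaging_tendsto_zero[OF range div])
    show "(\<lambda>t. - e t) \<longlonglongrightarrow> 0" using tendsto_minus[OF e] by simp
    show "D (Suc t) - e (Suc t) = (1 - \<gamma> t) * (D t - e t) + \<gamma> t * - e t" if "t \<ge> T" for t
      using rec[OF that] by (simp add: e_def algebra_simps)
  qed
  from tendsto_add[OF this e] show ?thesis by simp
qed

section \<open>Almost sure convergence of transforms of bounded martingale differences\<close>

locale martingale_difference = prob_space M for M :: "'a measure" +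
  fixes F :: "nat \<Rightarrow> 'a measure" and \<xi> :: "nat \<Rightarrow> 'a \<Rightarrow> real"
  assumes filt: "filtration (space M) F"
    and sub: "\<And>t. subalgebra M (F t)"
    and \<xi>_meas: "\<And>t. \<xi> t \<in> borel_measurable (F (Suc t))"
    and \<xi>_bound: "\<And>t \<omega>. \<omega> \<in> space M \<Longrightarrow> \<bar>\<xi> t \<omega>\<bar> \<le> 1"
    and \<xi>_cond: "\<And>t. AE \<omega> in M. real_cond_exp M (F t) (\<xi> t) \<omega> = 0"
begin

lemma meas_mono: "f \<in> measurable (F s) N \<Longrightarrow> s \<le> t \<Longrightarrow> f \<in> measurable (F t) N"
  using filtration.sets_F_mono[OF filt, of s t] filtration.space_F[OF filt]
  by (auto simp: measurable_def)

lemma meas_M: "f \<in> measurable (F s) N \<Longrightarrow> f \<in> measurable M N"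
  using sub by (rule measurable_from_subalg)

text \<open>A martingale transform. In this indexing a multiplier is predictable when
  \<open>h k\<close> is \<open>F k\<close>-measurable, because \<open>\<xi> k\<close> is revealed
  only in \<open>F (Suc k)\<close>.\<close>

definition transform :: "(nat \<Rightarrow> 'a \<Rightarrow> real) \<Rightarrow> nat \<Rightarrow> 'a \<Rightarrow> real" where
  "transform h n \<omega> = (\<Sum>k<n. h k \<omega> * \<xi> k \<omega>)"

lemma transform_meas:
  assumes "\<And>k. h k \<in> borel_measurable (F k)"
  shows "transform h n \<in> borel_measurable (F n)"
  unfolding transform_def
proof (rule borel_measurable_sum)
  fix k assume "k \<in> {..<n}"
  then show "(\<lambda>\<omega>. h k \<omega> * \<xi> k \<omega>) \<in> borel_measurable (F n)"
    using meas_mono[OF assms, of k n] meas_mono[OF \<xi>_meas, of k n]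
    by (intro borel_measurable_times) auto
qed

lemma transform_bound:
  assumes "\<And>k. \<bar>h k \<omega>\<bar> \<le> 1" "\<omega> \<in> space M"
  shows "\<bar>transform h n \<omega>\<bar> \<le> real n"
proof -
  have "\<bar>transform h n \<omega>\<bar> \<le> (\<Sum>k<n. \<bar>h k \<omega> * \<xi> k \<omega>\<bar>)"
    unfolding transform_def by (rule sum_abs)
  also have "\<dots> \<le> (\<Sum>k<n. 1)"
    using assms(1) \<xi>_bound[OF assms(2)]
    by (intro sum_mono) (auto simp: abs_mult intro!: mult_le_one)
  finally show ?thesis by simp
qed

text \<open>Increments are orthogonal: the past sum times \<open>h n\<close> is
  \<open>F n\<close>-measurable, so \<open>\<xi> n\<close> may be replaced by its conditional
  expectation 0 in the cross term. The new square is at most that of \<open>h n\<close> because the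
  differences are bounded by 1.\<close>

lemma transform_second_moment:
  assumes h: "\<And>k. h k \<in> borel_measurable (F k)"
    and hb: "\<And>k \<omega>. \<omega> \<in> space M \<Longrightarrow> \<bar>h k \<omega>\<bar> \<le> 1"
  shows "expectation (\<lambda>\<omega>. (transform h n \<omega>)\<^sup>2) \<le> (\<Sum>k<n. expectation (\<lambda>\<omega>. (h k \<omega>)\<^sup>2))"
proof (induction n)
  case 0
  then show ?case by (simp add: transform_def)
next
  case (Suc n)
  let ?S = "transform h n"
  have SF: "?S \<in> borel_measurable (F n)" by (rule transform_meas[OF h])
  have [measurable]: "?S \<in> borel_measurable M" "h n \<in> borel_measurable M" "\<xi> n \<in> borel_measurable M"
    using meas_M[OF SF] meas_M[OF h] meas_M[OF \<xi>_meas] by auto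
  have Sb: "\<bar>?S \<omega>\<bar> \<le> real n" if "\<omega> \<in> space M" for \<omega>
    using transform_bound hb that by blast
  have int1: "integrable M (\<lambda>\<omega>. (?S \<omega>)\<^sup>2)"
    using power_mono[OF Sb, of _ 2] by (intro integrable_const_bound[where B = "(real n)\<^sup>2"]) (auto intro!: AE_I2)
  have int2: "integrable M (\<lambda>\<omega>. (?S \<omega> * h n \<omega>) * \<xi> n \<omega>)"
  proof (intro integrable_const_bound[where B = "real n"] AE_I2)
    fix \<omega> assume \<omega>: "\<omega> \<in> space M"
    have "\<bar>?S \<omega>\<bar> * \<bar>h n \<omega>\<bar> * \<bar>\<xi> n \<omega>\<bar> \<le> real n * 1 * 1"
      using Sb[OF \<omega>] hb[OF \<omega>] \<xi>_bound[OF \<omega>] by (intro mult_mono) auto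
    then show "norm (?S \<omega> * h n \<omega> * \<xi> n \<omega>) \<le> real n" by (simp add: abs_mult)
  qed simp
  have hx: "(h n \<omega> * \<xi> n \<omega>)\<^sup>2 \<le> (h n \<omega>)\<^sup>2" "(h n \<omega>)\<^sup>2 \<le> 1" if "\<omega> \<in> space M" for \<omega>
    using \<xi>_bound[OF that, of n] hb[OF that, of n]
    by (auto simp: power_mult_distrib abs_square_le_1 intro!: mult_left_le)
  have int3: "integrable M (\<lambda>\<omega>. (h n \<omega> * \<xi> n \<omega>)\<^sup>2)" and int4: "integrable M (\<lambda>\<omega>. (h n \<omega>)\<^sup>2)"
    using order_trans[OF hx] hx(2) by (auto intro!: integrable_const_bound[where B = 1] AE_I2)
  have cross: "expectation (\<lambda>\<omega>. (?S \<omega> * h n \<omega>) * \<xi> n \<omega>) = 0"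
  proof -
    interpret FS: finite_measure_subalgebra M "F n"
      by unfold_locales (rule sub)
    have "expectation (\<lambda>\<omega>. (?S \<omega> * h n \<omega>) * \<xi> n \<omega>)
        = expectation (\<lambda>\<omega>. (?S \<omega> * h n \<omega>) * real_cond_exp M (F n) (\<xi> n) \<omega>)"
      using FS.real_cond_exp_intg(2)[OF int2] SF h by simp
    also have "\<dots> = expectation (\<lambda>_. 0)"
      using \<xi>_cond[of n] by (intro integral_cong_AE) auto
    finally show ?thesis by simp
  qed
  have "(transform h (Suc n) \<omega>)\<^sup>2 = (?S \<omega>)\<^sup>2 + 2 * ((?S \<omega> * h n \<omega>) * \<xi> n \<omega>) + (h n \<omega> * \<xi> n \<omega>)\<^sup>2" for \<omega>
    by (simp add: transform_def power2_eq_square algebra_simps)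
  then have "expectation (\<lambda>\<omega>. (transform h (Suc n) \<omega>)\<^sup>2)
      = expectation (\<lambda>\<omega>. (?S \<omega>)\<^sup>2) + 2 * expectation (\<lambda>\<omega>. (?S \<omega> * h n \<omega>) * \<xi> n \<omega>)
        + expectation (\<lambda>\<omega>. (h n \<omega> * \<xi> n \<omega>)\<^sup>2)"
    using int1 int2 int3 by simp
  also have "\<dots> \<le> (\<Sum>k<n. expectation (\<lambda>\<omega>. (h k \<omega>)\<^sup>2)) + expectation (\<lambda>\<omega>. (h n \<omega>)\<^sup>2)"
    using Suc cross integral_mono[OF int3 int4 hx(1)] by simp
  finally show ?case by simp
qed

text \<open>Kolmogorov's argument: switching the multiplier off after the first excursion
  keeps it predictable, and the stopped sum retains the excursion.\<close>

lemma maximal_inequality: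
  assumes g: "\<And>k. g k \<in> borel_measurable (F k)"
    and gb: "\<And>k \<omega>. \<omega> \<in> space M \<Longrightarrow> \<bar>g k \<omega>\<bar> \<le> 1"
    and lam: "c > 0"
  shows "prob {\<omega> \<in> space M. \<exists>j\<in>{m..n}. \<bar>transform g j \<omega> - transform g m \<omega>\<bar> > c}
           \<le> (\<Sum>k\<in>{m..<n}. expectation (\<lambda>\<omega>. (g k \<omega>)\<^sup>2)) / c\<^sup>2"
    (is "prob ?A \<le> _")
proof -
  define S where "S = transform g"
  \<comment> \<open>The clause \<open>m \<le> k\<close> makes the multiplier vanish before time
    \<open>m\<close>, so the transform of \<open>h\<close> starts there.\<close>
  define ok where "ok k \<omega> \<longleftrightarrow> m \<le> k \<and> (\<forall>j\<in>{m..k}. \<bar>S j \<omega> - S m \<omega>\<bar> \<le> c)" for k \<omega>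
  define h where "h k \<omega> = (if ok k \<omega> then g k \<omega> else 0)" for k \<omega>
  have Sm: "S j \<in> borel_measurable (F k)" if "j \<le> k" for j k
    unfolding S_def using meas_mono[OF transform_meas[OF g] that] .
  have ok_meas: "Measurable.pred (F k) (ok k)" for k
  proof (cases "m \<le> k")
    case True
    have "Measurable.pred (F k) (\<lambda>\<omega>. \<forall>j\<in>{m..k}. \<bar>S j \<omega> - S m \<omega>\<bar> \<le> c)"
    proof (rule pred_intros_finite(3))
      fix j assume "j \<in> {m..k}"
      then have [measurable]: "S j \<in> borel_measurable (F k)" "S m \<in> borel_measurable (F k)"
        using Sm True by auto
      show "Measurable.pred (F k) (\<lambda>\<omega>. \<bar>S j \<omega> - S m \<omega>\<bar> \<le> c)" by measurable
    qed simp
    then show ?thesis using True by (simp add: ok_def[abs_def])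
  qed (simp add: ok_def[abs_def])
  have h: "h k \<in> borel_measurable (F k)" for k
    unfolding h_def using ok_meas g by (intro measurable_If) (auto simp: pred_def)
  have hb: "\<bar>h k \<omega>\<bar> \<le> 1" if "\<omega> \<in> space M" for k \<omega>
    using gb[OF that] by (simp add: h_def)
  have hit: "c < \<bar>transform h n \<omega>\<bar>" if ex: "\<exists>j\<in>{m..n}. \<bar>S j \<omega> - S m \<omega>\<bar> > c" for \<omega>
  proof -
    define j where "j = (LEAST j. m \<le> j \<and> \<bar>S j \<omega> - S m \<omega>\<bar> > c)"
    from ex obtain i where i: "m \<le> i \<and> \<bar>S i \<omega> - S m \<omega>\<bar> > c" "i \<le> n" by auto
    have j: "m \<le> j" "\<bar>S j \<omega> - S m \<omega>\<bar> > c"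
      using LeastI[of "\<lambda>j. m \<le> j \<and> \<bar>S j \<omega> - S m \<omega>\<bar> > c", OF i(1)]
      unfolding j_def[symmetric] by blast+
    have "j \<le> n"
      using Least_le[of "\<lambda>j. m \<le> j \<and> \<bar>S j \<omega> - S m \<omega>\<bar> > c", OF i(1)] i(2)
      unfolding j_def[symmetric] by simp
    \<comment> \<open>Since \<open>j\<close> is the first excursion time, the multiplier is on
      exactly for \<open>m \<le> k < j\<close>, and the transform freezes at the increment from
      \<open>m\<close> to \<open>j\<close>.\<close>
    have ok_iff: "ok k \<omega> \<longleftrightarrow> m \<le> k \<and> k < j" for k
    proof
      assume "ok k \<omega>" then show "m \<le> k \<and> k < j"
        using j by (auto simp: ok_def) (metis atLeastAtMost_iff linorder_not_le)
    next
      assume k: "m \<le> k \<and> k < j"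
      have "\<bar>S i \<omega> - S m \<omega>\<bar> \<le> c" if "i \<in> {m..k}" for i
        using not_less_Least[of i "\<lambda>j. m \<le> j \<and> \<bar>S j \<omega> - S m \<omega>\<bar> > c"] k that
        unfolding j_def[symmetric] by auto
      then show "ok k \<omega>" using k by (simp add: ok_def)
    qed
    have "transform h n \<omega> = (\<Sum>k\<in>{..<n}. if k \<in> {m..<j} then g k \<omega> * \<xi> k \<omega> else 0)"
      unfolding transform_def h_def ok_iff by (intro sum.cong) auto
    also have "\<dots> = (\<Sum>k\<in>{m..<j}. g k \<omega> * \<xi> k \<omega>)"
      using \<open>j \<le> n\<close> by (subst sum.inter_restrict[symmetric]) (auto intro!: sum.cong)
    also have "\<dots> = S j \<omega> - S m \<omega>"
      using j(1) by (simp add: S_def transform_def lessThan_atLeast0 sum_diff_nat_ivl)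
    finally show ?thesis using j by simp
  qed
  have hM [measurable]: "transform h n \<in> borel_measurable M"
    using meas_M[OF transform_meas[OF h]] .
  have "integrable M (\<lambda>\<omega>. (transform h n \<omega>)\<^sup>2)"
    using power_mono[OF transform_bound[OF hb] abs_ge_zero, where n = 2]
    by (intro integrable_const_bound[where B = "(real n)\<^sup>2"]) (auto intro!: AE_I2)
  then have mk: "prob {\<omega>\<in>space M. (transform h n \<omega>)\<^sup>2 \<ge> c\<^sup>2} \<le> expectation (\<lambda>\<omega>. (transform h n \<omega>)\<^sup>2) / c\<^sup>2"
    using lam by (intro integral_Markov_inequality_measure[where A = "{}"]) auto
  have "prob ?A \<le> prob {\<omega>\<in>space M. (transform h n \<omega>)\<^sup>2 \<ge> c\<^sup>2}"
  proof (rule finite_measure_mono)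
    show "?A \<subseteq> {\<omega>\<in>space M. (transform h n \<omega>)\<^sup>2 \<ge> c\<^sup>2}"
      using hit lam by (force simp: S_def abs_le_square_iff[symmetric])
  qed measurable
  also note mk
  also have "expectation (\<lambda>\<omega>. (transform h n \<omega>)\<^sup>2) \<le> (\<Sum>k\<in>{m..<n}. expectation (\<lambda>\<omega>. (g k \<omega>)\<^sup>2))"
  proof -
    have *: "expectation (\<lambda>\<omega>. (h k \<omega>)\<^sup>2) \<le> (if k \<in> {m..<n} then expectation (\<lambda>\<omega>. (g k \<omega>)\<^sup>2) else 0)"
      if "k < n" for k
    proof (cases "m \<le> k")
      case True
      have [measurable]: "h k \<in> borel_measurable M" "g k \<in> borel_measurable M"
        by (rule meas_M[OF h], rule meas_M[OF g])
      have "expectation (\<lambda>\<omega>. (h k \<omega>)\<^sup>2) \<le> expectation (\<lambda>\<omega>. (g k \<omega>)\<^sup>2)"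
      proof (intro integral_mono integrable_const_bound[where B = 1] AE_I2)
        show "(h k \<omega>)\<^sup>2 \<le> (g k \<omega>)\<^sup>2" for \<omega> by (simp add: h_def)
      qed (use hb gb in \<open>auto simp: abs_square_le_1\<close>)
      then show ?thesis using True that by simp
    qed (simp add: h_def ok_def)
    have "expectation (\<lambda>\<omega>. (transform h n \<omega>)\<^sup>2) \<le> (\<Sum>k<n. expectation (\<lambda>\<omega>. (h k \<omega>)\<^sup>2))"
      by (rule transform_second_moment[OF h hb])
    also have "\<dots> \<le> (\<Sum>k<n. if k \<in> {m..<n} then expectation (\<lambda>\<omega>. (g k \<omega>)\<^sup>2) else 0)"
      using * by (intro sum_mono) auto
    also have "\<dots> = (\<Sum>k\<in>{m..<n}. expectation (\<lambda>\<omega>. (g k \<omega>)\<^sup>2))"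
      by (subst sum.inter_restrict[symmetric]) (auto intro!: sum.cong)
    finally show ?thesis .
  qed
  finally show ?thesis using lam by (simp add: divide_right_mono)
qed

text \<open>The bound \<open>K\<close> makes the second moments summable. By the maximal inequality,
  an excursion beyond \<open>c\<close> after time \<open>m\<close> has probability at most a tail of
  this series divided by the square of \<open>c\<close>, and the tails vanish as \<open>m\<close>
  grows. Hence almost every path is Cauchy.\<close>

lemma transform_convergent:
  assumes g: "\<And>k. g k \<in> borel_measurable (F k)"
    and gb: "\<And>k \<omega>. \<omega> \<in> space M \<Longrightarrow> \<bar>g k \<omega>\<bar> \<le> 1"
    and K: "\<And>n \<omega>. \<omega> \<in> space M \<Longrightarrow> (\<Sum>k<n. (g k \<omega>)\<^sup>2) \<le> K"
  shows "AE \<omega> in M. convergent (\<lambda>n. transform g n \<omega>)"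
proof -
  define q where "q k = expectation (\<lambda>\<omega>. (g k \<omega>)\<^sup>2)" for k
  have gM [measurable]: "g k \<in> borel_measurable M" for k using g meas_M by auto
  have int: "integrable M (\<lambda>\<omega>. (g k \<omega>)\<^sup>2)" for k
    using gb by (intro integrable_const_bound[where B = 1]) (auto intro!: AE_I2 simp: abs_square_le_1)
  have q0: "0 \<le> q k" for k by (simp add: q_def)
  have SM [measurable]: "transform g j \<in> borel_measurable M" for j
    using meas_M[OF transform_meas[OF g]] .
  have "summable q"
  proof (rule summableI_nonneg_bounded)
    show "0 \<le> q k" for k by (simp add: q_def)
    show "(\<Sum>k<n. q k) \<le> K" for n
    proof -
      have "(\<Sum>k<n. q k) = expectation (\<lambda>\<omega>. \<Sum>k<n. (g k \<omega>)\<^sup>2)"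
        unfolding q_def using int by simp
      also have "\<dots> \<le> expectation (\<lambda>_. K)"
        using int K by (intro integral_mono) auto
      finally show ?thesis by (simp add: prob_space)
    qed
  qed
  define tail where "tail m = (\<Sum>k. q (k + m))" for m
  have tail0: "tail \<longlonglongrightarrow> 0"
    unfolding tail_def using suminf_exist_split2[OF \<open>summable q\<close>] .
  define B where "B c m n = {\<omega> \<in> space M. \<exists>j\<in>{m..n}. \<bar>transform g j \<omega> - transform g m \<omega>\<bar> > c}"
    for c m n
  \<comment> \<open>The event that from every time \<open>m\<close> on the path still moves by more
    than \<open>c\<close>; it lies in the union of the \<open>B c m n\<close> over \<open>n\<close>
    for each \<open>m\<close>. A path outside all \<open>C (1 / Suc i)\<close> is Cauchy.\<close>
  define C where "C c = {\<omega> \<in> space M. \<forall>m. \<exists>j\<ge>m. \<bar>transform g j \<omega> - transform g m \<omega>\<bar> > c}" for c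
  have BM [measurable]: "B c m n \<in> sets M" for c m n unfolding B_def by measurable
  have CM [measurable]: "C c \<in> sets M" for c unfolding C_def by measurable
  have C0: "prob (C c) = 0" if lam: "c > 0" for c
  proof -
    have "prob (C c) \<le> tail m / c\<^sup>2" for m
    proof -
      have "(\<lambda>n. prob (B c m n)) \<longlonglongrightarrow> prob (\<Union>n. B c m n)"
        by (intro finite_Lim_measure_incseq) (auto simp: incseq_def B_def)
      moreover have "prob (B c m n) \<le> tail m / c\<^sup>2" for n
      proof -
        have "(\<Sum>k\<in>{m..<n}. q k) = (\<Sum>k\<in>(\<lambda>k. k + m) ` {..<n-m}. q k)"
        proof (rule sum.cong[OF _ refl], intro equalityI subsetI)
          fix k assume "k \<in> {m..<n}"
          then show "k \<in> (\<lambda>k. k + m) ` {..<n-m}" by (intro image_eqI[of _ _ "k - m"]) auto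
        qed auto
        also have "\<dots> = (\<Sum>k<n-m. q (k + m))"
          by (subst sum.reindex) (auto simp: inj_on_def)
        also have "\<dots> \<le> tail m"
          unfolding tail_def using \<open>summable q\<close>
          by (intro sum_le_suminf) (auto simp: q_def[symmetric] summable_iff_shift[of q] intro: q0)
        finally show ?thesis
          using maximal_inequality[OF g gb lam, of m n] lam
          unfolding B_def q_def[symmetric] by (meson divide_right_mono order_trans zero_le_power2)
      qed
      ultimately have "prob (\<Union>n. B c m n) \<le> tail m / c\<^sup>2"
        by (intro LIMSEQ_le_const2) auto
      moreover have "prob (C c) \<le> prob (\<Union>n. B c m n)"
      proof (rule finite_measure_mono)
        show "C c \<subseteq> (\<Union>n. B c m n)"
        proof
          fix \<omega> assume "\<omega> \<in> C c"
          then obtain j where "\<omega> \<in> space M" "j \<ge> m" "\<bar>transform g j \<omega> - transform g m \<omega>\<bar> > c"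
            by (auto simp: C_def)
          then have "\<omega> \<in> B c m j" by (auto simp: B_def)
          then show "\<omega> \<in> (\<Union>n. B c m n)" by blast
        qed
      qed simp
      ultimately show ?thesis by simp
    qed
    moreover have "(\<lambda>m. tail m / c\<^sup>2) \<longlonglongrightarrow> 0 / c\<^sup>2"
      using lam by (intro tendsto_divide tail0 tendsto_const) auto
    ultimately have "prob (C c) \<le> 0"
      by (intro LIMSEQ_le_const[where X = "\<lambda>m. tail m / c\<^sup>2"]) auto
    then show ?thesis by (simp add: measure_le_0_iff)
  qed
  have "AE \<omega> in M. \<forall>i. \<omega> \<notin> C (1 / Suc i)"
    unfolding AE_all_countable using C0 by (auto simp: AE_iff_measurable[OF CM] emeasure_eq_measure intro!: AE_not_in)
  then show ?thesis
  proof (rule AE_mp, intro AE_I2 impI)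
    fix \<omega> assume \<omega>: "\<omega> \<in> space M" "\<forall>i. \<omega> \<notin> C (1 / Suc i)"
    have "Cauchy (\<lambda>n. transform g n \<omega>)"
    proof (rule metric_CauchyI)
      fix e :: real assume "e > 0"
      then obtain i where i: "1 / real (Suc i) < e / 2" using nat_approx_posE[of "e/2"] by auto
      obtain m where m: "\<And>j. j \<ge> m \<Longrightarrow> \<bar>transform g j \<omega> - transform g m \<omega>\<bar> \<le> 1 / Suc i"
        using \<omega> spec[OF \<omega>(2), of i] unfolding C_def by (auto simp: not_less)
      show "\<exists>m. \<forall>a\<ge>m. \<forall>b\<ge>m. dist (transform g a \<omega>) (transform g b \<omega>) < e"
      proof (intro exI allI impI)
        fix a b assume "a \<ge> m" "b \<ge> m"
        then show "dist (transform g a \<omega>) (transform g b \<omega>) < e"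
          using m[of a] m[of b] i by (simp add: dist_real_def)
      qed
    qed
    then show "convergent (\<lambda>n. transform g n \<omega>)" by (simp add: Cauchy_convergent_iff)
  qed
qed

text \<open>Localization: cutting the multipliers off when their square sum exceeds \<open>K\<close>
  gives a transform covered by the bounded case. Almost every path has a finite square sum, so for
  some integer \<open>K\<close> the cut never acts on it.\<close>

lemma transform_convergent_square_summable:
  assumes g: "\<And>k. g k \<in> borel_measurable (F k)"
    and gb: "\<And>k \<omega>. \<omega> \<in> space M \<Longrightarrow> \<bar>g k \<omega>\<bar> \<le> 1"
    and sq: "AE \<omega> in M. summable (\<lambda>k. (g k \<omega>)\<^sup>2)"
  shows "AE \<omega> in M. convergent (\<lambda>n. \<Sum>k<n. g k \<omega> * \<xi> k \<omega>)"
proof -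
  \<comment> \<open>The running sum includes index \<open>k\<close> itself. This keeps the
    multiplier \<open>F k\<close>-measurable and the truncated square sum at most \<open>K\<close>,
    without overshoot.\<close>
  define gK where "gK K k \<omega> = (if (\<Sum>j\<le>k. (g j \<omega>)\<^sup>2) \<le> real K then g k \<omega> else 0)" for K :: nat and k \<omega>
  have meas: "gK K k \<in> borel_measurable (F k)" for K k
  proof -
    have [measurable]: "g j \<in> borel_measurable (F k)" if "j \<in> {..k}" for j
      using meas_mono[OF g] that by auto
    have [measurable]: "(\<lambda>\<omega>. \<Sum>j\<le>k. (g j \<omega>)\<^sup>2) \<in> borel_measurable (F k)"
      by (intro borel_measurable_sum borel_measurable_power) auto
    show ?thesis unfolding gK_def by measurable
  qed
  have bound: "(\<Sum>k<n. (gK K k \<omega>)\<^sup>2) \<le> real K" for K n \<omega>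
  proof (induction n)
    case (Suc n)
    show ?case
    proof (cases "(\<Sum>j\<le>n. (g j \<omega>)\<^sup>2) \<le> real K")
      case True
      have "(\<Sum>k<Suc n. (gK K k \<omega>)\<^sup>2) \<le> (\<Sum>j<Suc n. (g j \<omega>)\<^sup>2)"
        by (intro sum_mono) (simp add: gK_def)
      then show ?thesis using True by (simp add: lessThan_Suc_atMost)
    qed (use Suc in \<open>simp add: gK_def\<close>)
  qed simp
  have "AE \<omega> in M. \<forall>K. convergent (\<lambda>n. transform (gK K) n \<omega>)"
    unfolding AE_all_countable
  proof
    show "AE \<omega> in M. convergent (\<lambda>n. transform (gK K) n \<omega>)" for K
      by (rule transform_convergent[OF meas _ bound]) (simp add: gK_def gb)
  qed
  with sq show ?thesis
  proof eventually_elim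
    case (elim \<omega>)
    obtain K :: nat where K: "(\<Sum>k. (g k \<omega>)\<^sup>2) \<le> real K" using real_arch_simple by blast
    have "gK K k \<omega> = g k \<omega>" for k
      using sum_le_suminf[OF elim(1), of "{..k}"] K by (simp add: gK_def)
    then show ?case using spec[OF elim(2), of K] by (simp add: transform_def)
  qed
qed

end

subsection \<open>Asynchronous averaging iterations along one sample path\<close>

text \<open>Everything here is deterministic: randomness enters only through \<open>avg\<close>,
  which states that averages of a fixed function of the sampled successors converge to its mean. The
  map \<open>m\<close> is abstract so that the locale can be instantiated a second time with signs
  reversed, turning upper bounds into lower ones.\<close>

locale async_iteration =
  fixes R :: "'l set" and n :: nat
    and m :: "('l \<Rightarrow> real) \<Rightarrow> nat \<Rightarrow> real"
    and c p :: "'l \<Rightarrow> nat \<Rightarrow> real"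
    and x :: "nat \<Rightarrow> 'l \<Rightarrow> real"
    and \<gamma> :: "nat \<Rightarrow> 'l \<Rightarrow> real"
    and \<tau> :: "nat \<Rightarrow> 'l \<Rightarrow> 'l \<Rightarrow> nat"
    and js :: "nat \<Rightarrow> 'l \<Rightarrow> nat"
  assumes finite_R: "finite R"
    and m_shift: "\<And>y z r s. r \<ge> 0 \<Longrightarrow> s \<le> n \<Longrightarrow> (\<And>l. l \<in> R \<Longrightarrow> y l \<le> z l + r) \<Longrightarrow> m y s \<le> m z s + r"
    and \<gamma>: "\<And>t l. l \<in> R \<Longrightarrow> 0 \<le> \<gamma> t l \<and> \<gamma> t l \<le> 1"
    and \<tau>_le: "\<And>t l l'. l \<in> R \<Longrightarrow> l' \<in> R \<Longrightarrow> \<tau> t l l' \<le> t"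
    and \<tau>_lim: "\<And>l l'. l \<in> R \<Longrightarrow> l' \<in> R \<Longrightarrow> filterlim (\<lambda>t. \<tau> t l l') at_top sequentially"
    and js: "\<And>t l. l \<in> R \<Longrightarrow> js t l \<le> n"
    and iter: "\<And>t l. l \<in> R \<Longrightarrow> x (Suc t) l =
      (1 - \<gamma> t l) * x t l + \<gamma> t l * (c l (js t l) + m (\<lambda>l'. x (\<tau> t l l') l') (js t l))"
    and avg: "\<And>l f T b. l \<in> R \<Longrightarrow>
      (\<And>t. t \<ge> T \<Longrightarrow> b (Suc t) = (1 - \<gamma> t l) * b t + \<gamma> t l * f (js t l)) \<Longrightarrow>
      b \<longlonglongrightarrow> (\<Sum>s\<le>n. p l s * f s)"
begin

definition op :: "('l \<Rightarrow> real) \<Rightarrow> 'l \<Rightarrow> real" where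
  "op y l = (\<Sum>s\<le>n. p l s * (c l s + m y s))"

text \<open>A comparison process with the stepsizes and successors of the iteration but a frozen
  update \<open>f\<close>, started from \<open>b0\<close> at time \<open>T\<close>. Freezing
  \<open>f\<close> is what lets \<open>avg\<close> determine its limit.\<close>

primrec emp :: "nat \<Rightarrow> 'l \<Rightarrow> real \<Rightarrow> (nat \<Rightarrow> real) \<Rightarrow> nat \<Rightarrow> real" where
  "emp T l b0 f 0 = b0"
| "emp T l b0 f (Suc t) = (if t < T then b0 else (1 - \<gamma> t l) * emp T l b0 f t + \<gamma> t l * f (js t l))"

lemma emp_initial: "t \<le> T \<Longrightarrow> emp T l b0 f t = b0"
  by (cases t) auto

lemma emp_limit: "l \<in> R \<Longrightarrow> emp T l b0 f \<longlonglongrightarrow> (\<Sum>s\<le>n. p l s * f s)"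
  by (rule avg[of _ T]) auto

text \<open>The two weights of an update sum to 1, so a common slack in the current value and in the
  sampled target survives the step; \<open>m_shift\<close> carries the slack of the delayed history
  into the target.\<close>

lemma iter_le:
  assumes l: "l \<in> R" and "r \<ge> 0" and b: "x t l \<le> b + r'" and "r' \<ge> r"
    and hist: "\<And>l'. l' \<in> R \<Longrightarrow> x (\<tau> t l l') l' \<le> y l' + r"
  shows "x (Suc t) l \<le> (1 - \<gamma> t l) * b + \<gamma> t l * (c l (js t l) + m y (js t l)) + r'"
proof -
  have "m (\<lambda>l'. x (\<tau> t l l') l') (js t l) \<le> m y (js t l) + r"
    using hist by (intro m_shift[OF \<open>r \<ge> 0\<close> js[OF l]])
  then have "c l (js t l) + m (\<lambda>l'. x (\<tau> t l l') l') (js t l) \<le> c l (js t l) + m y (js t l) + r'"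
    using \<open>r' \<ge> r\<close> by simp
  then have "x (Suc t) l \<le> (1 - \<gamma> t l) * (b + r') + \<gamma> t l * (c l (js t l) + m y (js t l) + r')"
    unfolding iter[OF l] using \<gamma>[OF l, of t] b
    by (intro add_mono[OF mult_left_mono mult_left_mono]) auto
  then show ?thesis by (simp add: algebra_simps)
qed

text \<open>The empirical averages of the updates of \<open>z\<close> converge to
  \<open>op z\<close>, which is strictly below \<open>z\<close>, so from some time \<open>T\<close>
  on they lie below \<open>z\<close>. A slack large enough up to time \<open>T\<close> therefore
  never has to grow.\<close>

lemma bounded_above:
  assumes z: "\<And>l. l \<in> R \<Longrightarrow> op z l < z l"
  shows "\<exists>B. \<forall>t. \<forall>l\<in>R. x t l \<le> B"
proof -
  define b where "b l = emp 0 l (z l) (\<lambda>s. c l s + m z s)" for l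
  have "eventually (\<lambda>t. b l t < z l) sequentially" if "l \<in> R" for l
    using emp_limit[OF that, of 0 "z l" "\<lambda>s. c l s + m z s"] z[OF that]
    unfolding b_def op_def by (rule order_tendstoD(2))
  then have "eventually (\<lambda>t. \<forall>l\<in>R. b l t < z l) sequentially"
    using finite_R by (simp add: eventually_ball_finite)
  then obtain T where T: "\<And>t l. t \<ge> T \<Longrightarrow> l \<in> R \<Longrightarrow> b l t < z l"
    by (auto simp: eventually_sequentially)
  \<comment> \<open>Only finitely many values occur up to time \<open>T\<close>; the inserted 0
    makes the slack nonnegative and covers empty \<open>R\<close>.\<close>
  define r where "r = Max (insert 0 ((\<lambda>(t, l). x t l - z l) ` ({..T} \<times> R)))"
  have r: "r \<ge> 0" "\<And>t l. t \<le> T \<Longrightarrow> l \<in> R \<Longrightarrow> x t l \<le> z l + r"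
  proof -
    show "r \<ge> 0" unfolding r_def using finite_R by (intro Max_ge) auto
    show "x t l \<le> z l + r" if "t \<le> T" "l \<in> R" for t l
    proof -
      have "x t l - z l \<le> r" unfolding r_def using finite_R that by (intro Max_ge) force+
      then show ?thesis by simp
    qed
  qed
  \<comment> \<open>The two bounds support each other: the bound by \<open>z\<close> on the delayed
    iterates propagates the bound by \<open>b\<close>, which in turn gives the bound by
    \<open>z\<close> after \<open>T\<close>. Strong induction is needed since delays may reach far
    back.\<close>
  have main: "(\<forall>l\<in>R. x t l \<le> b l t + r \<and> x t l \<le> z l + r)" for t
  proof (induction t rule: less_induct)
    case (less t)
    show ?case
    proof (cases t)
      case 0
      then show ?thesis using r(2)[of 0] by (simp add: b_def)
    next
      case (Suc t')
      have "x t l \<le> b l t + r" if l: "l \<in> R" for l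
        using iter_le[OF l r(1), of t' "b l t'" r z] less[of t'] less \<tau>_le[OF l, of _ t'] l Suc
        by (auto simp: b_def le_imp_less_Suc)
      moreover have "x t l \<le> z l + r" if l: "l \<in> R" for l
        using calculation[OF l] T[of t l] r(2)[of t l] l by (cases "t \<le> T") auto
      ultimately show ?thesis by blast
    qed
  qed
  define B where "B = Max (insert 0 (z ` R)) + r"
  have "x t l \<le> B" if "l \<in> R" for t l
  proof -
    have "z l \<le> Max (insert 0 (z ` R))" using finite_R that by (intro Max_ge) auto
    then show ?thesis using main[of t] that unfolding B_def by fastforce
  qed
  then show ?thesis by blast
qed

text \<open>Once all delayed iterates lie below their limit superiors up to \<open>r\<close>, the iterate is an average of sampled updates, whose empirical weights converge.\<close>

lemma limsup_subsolution:
  assumes above: "\<And>t l. l \<in> R \<Longrightarrow> x t l \<le> B" and below: "\<And>t l. l \<in> R \<Longrightarrow> A \<le> x t l"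
  shows "\<exists>u. (\<forall>l\<in>R. \<forall>r>0. eventually (\<lambda>t. x t l \<le> u l + r) sequentially) \<and> (\<forall>l\<in>R. u l \<le> op u l)"
proof -
  \<comment> \<open>The infimum of the eventual upper bounds is the limit superior; the bounds
    \<open>A\<close> and \<open>B\<close> make this real infimum meaningful.\<close>
  define E where "E l = {a. eventually (\<lambda>t. x t l \<le> a) sequentially}" for l
  define u where "u l = Inf (E l)" for l
  have EB: "B \<in> E l" if "l \<in> R" for l using above[OF that] by (simp add: E_def)
  have EA: "A \<le> a" if "l \<in> R" and a: "a \<in> E l" for l a
  proof -
    obtain t where "x t l \<le> a"
      using a unfolding E_def by (auto dest: eventually_happens)
    then show ?thesis using below[OF that(1), of t] by simp
  qed
  have bdd: "bdd_below (E l)" if "l \<in> R" for l using EA[OF that] by (auto simp: bdd_below_def)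
  have ev: "eventually (\<lambda>t. x t l \<le> u l + r) sequentially" if l: "l \<in> R" and r: "r > 0" for l r
  proof -
    obtain a where "a \<in> E l" "a < u l + r"
      using cInf_lessD[of "E l" "u l + r"] EB[OF l] r unfolding u_def by auto
    then show ?thesis unfolding E_def by (auto elim: eventually_mono)
  qed
  have "u l \<le> op u l" if l: "l \<in> R" for l
  proof (rule field_le_epsilon)
    fix e :: real assume "e > 0"
    define r where "r = e / 2"
    have r: "r > 0" using \<open>e > 0\<close> by (simp add: r_def)
    have "eventually (\<lambda>t. \<forall>l'\<in>R. x t l' \<le> u l' + r) sequentially"
      using finite_R ev[OF _ r] by (simp add: eventually_ball_finite)
    then obtain T0 where T0: "\<And>t l'. t \<ge> T0 \<Longrightarrow> l' \<in> R \<Longrightarrow> x t l' \<le> u l' + r"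
      by (auto simp: eventually_sequentially)
    have "eventually (\<lambda>t. \<forall>l'\<in>R. T0 \<le> \<tau> t l l') sequentially"
      using finite_R \<tau>_lim[OF l] by (auto simp: eventually_ball_finite filterlim_at_top)
    then obtain T where T: "\<And>t l'. t \<ge> T \<Longrightarrow> l' \<in> R \<Longrightarrow> T0 \<le> \<tau> t l l'"
      by (auto simp: eventually_sequentially)
    \<comment> \<open>The comparison process starts at the iterate itself, at a time
      \<open>T\<close> from which all delays refer to times after \<open>T0\<close>.\<close>
    define b where "b = emp T l (x T l) (\<lambda>s. c l s + m u s)"
    have xb: "t \<ge> T \<Longrightarrow> x t l \<le> b t + r" for t
    proof (induction t rule: dec_induct)
      case base
      then show ?case using r by (simp add: b_def emp_initial)
    next
      case (step t)
      have "x (Suc t) l \<le> (1 - \<gamma> t l) * b t + \<gamma> t l * (c l (js t l) + m u (js t l)) + r"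
        using step r T T0 by (intro iter_le[OF l, where r = r]) auto
      then show ?case using step by (simp add: b_def)
    qed
    have "b \<longlonglongrightarrow> op u l" unfolding b_def op_def by (rule emp_limit[OF l])
    then have "eventually (\<lambda>t. b t < op u l + r) sequentially"
      using r by (intro order_tendstoD(2)) auto
    then have "eventually (\<lambda>t. x t l \<le> op u l + e) sequentially"
      using eventually_ge_at_top[of T] by eventually_elim (use xb in \<open>fastforce simp: r_def\<close>)
    then show "u l \<le> op u l + e"
      unfolding u_def by (intro cInf_lower bdd[OF l]) (simp add: E_def)
  qed
  with ev show ?thesis by blast
qed

end

subsection \<open>Strict supersolutions of finite Markov decision problems\<close>

text \<open>The Knaster-Tarski argument: the pointwise supremum \<open>z\<close> of all subsolutions
  is a subsolution by monotonicity, and so is \<open>G z\<close>, whence \<open>G z \<le> z\<close>.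
  The bound \<open>B\<close> keeps the suprema finite.\<close>

lemma greatest_subsolution:
  fixes G :: "('s \<Rightarrow> real) \<Rightarrow> 's \<Rightarrow> real" and S :: "'s set"
  assumes mono: "\<And>x y i. (\<And>j. j \<in> S \<Longrightarrow> x j \<le> y j) \<Longrightarrow> i \<in> S \<Longrightarrow> G x i \<le> G y i"
    and y0: "\<And>i. i \<in> S \<Longrightarrow> y0 i \<le> G y0 i"
    and bound: "\<And>y i. (\<And>j. j \<in> S \<Longrightarrow> y j \<le> G y j) \<Longrightarrow> i \<in> S \<Longrightarrow> y i \<le> B i"
  obtains z where "\<And>i. i \<in> S \<Longrightarrow> G z i = z i"
    and "\<And>y i. (\<And>j. j \<in> S \<Longrightarrow> y j \<le> G y j) \<Longrightarrow> i \<in> S \<Longrightarrow> y i \<le> z i"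
proof -
  define Sub where "Sub = {y. \<forall>j\<in>S. y j \<le> G y j}"
  define z where "z i = (SUP y\<in>Sub. y i)" for i
  have ne: "Sub \<noteq> {}" using y0 by (auto simp: Sub_def)
  have bdd: "bdd_above ((\<lambda>y. y i) ` Sub)" if "i \<in> S" for i
    using bound[OF _ that] by (intro bdd_aboveI2[of _ _ "B i"]) (auto simp: Sub_def)
  have up: "y i \<le> z i" if "y \<in> Sub" "i \<in> S" for y i
    unfolding z_def using that bdd by (intro cSUP_upper) auto
  have le: "z i \<le> G z i" if i: "i \<in> S" for i
    unfolding z_def[of i]
  proof (rule cSUP_least[OF ne])
    fix y assume y: "y \<in> Sub"
    then have "y i \<le> G y i" using i by (simp add: Sub_def)
    also have "\<dots> \<le> G z i" using up[OF y] i by (intro mono) auto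
    finally show "y i \<le> G z i" .
  qed
  have "G z \<in> Sub" using le mono by (auto simp: Sub_def)
  then have "G z i = z i" if "i \<in> S" for i using le[OF that] up[OF _ that] by (simp add: antisym)
  then show thesis using up by (intro that[of z]) (auto simp: Sub_def)
qed

text \<open>A maximizing player with continuation values \<open>x\<close>; a minimizing player is
  covered by reversing signs. With \<open>r = 0\<close>, \<open>val_shift\<close> is monotonicity;
  in general it says that shifts are not amplified, without any discounting.\<close>

locale finite_mdp =
  fixes S :: "'s set" and A :: "'s \<Rightarrow> 'a set" and val :: "('s \<Rightarrow> real) \<Rightarrow> 's \<Rightarrow> 'a \<Rightarrow> real"
  assumes finite_S: "finite S"
    and A: "\<And>i. i \<in> S \<Longrightarrow> finite (A i) \<and> A i \<noteq> {}"
    and val_shift: "\<And>x y r i a. i \<in> S \<Longrightarrow> a \<in> A i \<Longrightarrow> r \<ge> 0 \<Longrightarrow>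
      (\<And>j. j \<in> S \<Longrightarrow> x j \<le> y j + r) \<Longrightarrow> val x i a \<le> val y i a + r"
begin

definition T :: "('s \<Rightarrow> real) \<Rightarrow> 's \<Rightarrow> real" where
  "T y i = Max (val y i ` A i)"

lemma val_le_T: "i \<in> S \<Longrightarrow> a \<in> A i \<Longrightarrow> val y i a \<le> T y i"
  unfolding T_def using A by (intro Max_ge) auto

lemma T_attained: "i \<in> S \<Longrightarrow> \<exists>a\<in>A i. T y i = val y i a"
  unfolding T_def using Max_in[of "val y i ` A i"] A[of i] by fastforce

lemma T_shift:
  assumes "i \<in> S" "r \<ge> 0" "\<And>j. j \<in> S \<Longrightarrow> x j \<le> y j + r"
  shows "T x i \<le> T y i + r"
proof -
  obtain a where a: "a \<in> A i" "T x i = val x i a" using T_attained assms(1) by blast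
  then show ?thesis
    using val_shift[OF assms(1) a(1) assms(2), of x y] assms(3) val_le_T[OF assms(1) a(1), of y] by simp
qed

lemma T_mono: "(\<And>j. j \<in> S \<Longrightarrow> x j \<le> y j) \<Longrightarrow> i \<in> S \<Longrightarrow> T x i \<le> T y i"
  using T_shift[of i 0 x y] by simp

text \<open>The problem with costs increased by \<open>\<epsilon>\<close> is truncated at \<open>w + 1\<close>, \<open>w\<close> being the greatest
  subsolution. A state where the truncation is active for every \<open>\<epsilon>\<close> would survive the limit and
  give a subsolution exceeding \<open>w\<close>.\<close>

lemma strict_supersolution:
  assumes y0: "\<And>i. i \<in> S \<Longrightarrow> y0 i \<le> T y0 i"
    and bound: "\<And>d. d \<in> Pi\<^sub>E S A \<Longrightarrow>
      \<exists>B. \<forall>y. (\<forall>i\<in>S. y i \<le> val y i (d i)) \<longrightarrow> (\<forall>i\<in>S. y i \<le> B)"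
  shows "\<exists>z \<epsilon>. \<epsilon> > 0 \<and> (\<forall>i\<in>S. \<forall>a\<in>A i. val z i a + \<epsilon> \<le> z i)"
proof -
  have fin: "finite (Pi\<^sub>E S A)" using A finite_S by (intro finite_PiE) auto
  have "\<forall>d\<in>Pi\<^sub>E S A. \<exists>B. \<forall>y. (\<forall>i\<in>S. y i \<le> val y i (d i)) \<longrightarrow> (\<forall>i\<in>S. y i \<le> B)"
    using bound by blast
  from bchoice[OF this] obtain Bd where
    Bd: "\<forall>d\<in>Pi\<^sub>E S A. \<forall>y. (\<forall>i\<in>S. y i \<le> val y i (d i)) \<longrightarrow> (\<forall>i\<in>S. y i \<le> Bd d)" ..
  define B where "B = Max (insert 0 (Bd ` Pi\<^sub>E S A))"
  \<comment> \<open>A subsolution of the maximized operator is a subsolution for the rule that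
    selects the maximizing actions. There are finitely many rules, so the largest of their bounds is
    uniform.\<close>
  have subB: "y i \<le> B" if y: "\<And>j. j \<in> S \<Longrightarrow> y j \<le> T y j" and i: "i \<in> S" for y i
  proof -
    have "\<forall>j\<in>S. \<exists>a. a \<in> A j \<and> T y j = val y j a" using T_attained by blast
    from bchoice[OF this] obtain d0 where d0: "\<forall>j\<in>S. d0 j \<in> A j \<and> T y j = val y j (d0 j)" ..
    define d where "d = restrict d0 S"
    have d: "d \<in> Pi\<^sub>E S A" "\<And>j. j \<in> S \<Longrightarrow> y j \<le> val y j (d j)"
      using d0 y by (auto simp: d_def)
    have "y i \<le> Bd d" using Bd[rule_format, OF d(1), of y] d(2) i by blast
    also have "\<dots> \<le> B" unfolding B_def using d(1) fin by (intro Max_ge) auto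
    finally show ?thesis .
  qed
  obtain w where w: "\<And>i. i \<in> S \<Longrightarrow> T w i = w i"
    and wmax: "\<And>y i. (\<And>j. j \<in> S \<Longrightarrow> y j \<le> T y j) \<Longrightarrow> i \<in> S \<Longrightarrow> y i \<le> w i"
    by (rule greatest_subsolution[of S T y0 "\<lambda>_. B"]) (use T_mono y0 subB in blast)+
  define G where "G \<epsilon> y i = min (w i + 1) (T y i + \<epsilon>)" for \<epsilon> :: real and y i
  have "\<exists>z. (\<forall>i\<in>S. G \<epsilon> z i = z i) \<and> (\<forall>y. (\<forall>j\<in>S. y j \<le> G \<epsilon> y j) \<longrightarrow> (\<forall>i\<in>S. y i \<le> z i))"
    if "\<epsilon> > 0" for \<epsilon>
  proof (rule greatest_subsolution[of S "G \<epsilon>" w "\<lambda>i. w i + 1"])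
    show "G \<epsilon> x i \<le> G \<epsilon> y i" if "\<And>j. j \<in> S \<Longrightarrow> x j \<le> y j" "i \<in> S" for x y i
      using T_mono[of x y i] that by (auto simp: G_def min_le_iff_disj)
    show "w i \<le> G \<epsilon> w i" if "i \<in> S" for i using w[OF that] \<open>\<epsilon> > 0\<close> by (simp add: G_def)
    show "y i \<le> w i + 1" if "\<And>j. j \<in> S \<Longrightarrow> y j \<le> G \<epsilon> y j" "i \<in> S" for y i
      using that(1)[OF that(2)] by (simp add: G_def)
  qed blast
  then have "\<forall>\<epsilon>\<in>{0<..}. \<exists>z. (\<forall>i\<in>S. G \<epsilon> z i = z i) \<and> (\<forall>y. (\<forall>j\<in>S. y j \<le> G \<epsilon> y j) \<longrightarrow> (\<forall>i\<in>S. y i \<le> z i))"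
    by simp
  from bchoice[OF this] obtain z where
    zz: "\<forall>\<epsilon>\<in>{0<..}. (\<forall>i\<in>S. G \<epsilon> (z \<epsilon>) i = z \<epsilon> i) \<and> (\<forall>y. (\<forall>j\<in>S. y j \<le> G \<epsilon> y j) \<longrightarrow> (\<forall>i\<in>S. y i \<le> z \<epsilon> i))" ..
  have z: "G \<epsilon> (z \<epsilon>) i = z \<epsilon> i" if "\<epsilon> > 0" "i \<in> S" for \<epsilon> i
    using zz that by simp
  have zmax: "y i \<le> z \<epsilon> i" if "\<epsilon> > 0" "\<forall>j\<in>S. y j \<le> G \<epsilon> y j" "i \<in> S" for \<epsilon> y i
    using zz that by simp
  have touch: "\<exists>\<epsilon>>0. \<forall>i\<in>S. z \<epsilon> i < w i + 1"
  proof (rule ccontr)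
    assume neg: "\<not> ?thesis"
    have zle: "z \<epsilon> i \<le> w i + 1" "z \<epsilon> i \<le> T (z \<epsilon>) i + \<epsilon>" if "\<epsilon> > 0" "i \<in> S" for \<epsilon> i
      using z[OF that] by (simp_all add: G_def min_def split: if_splits)
    \<comment> \<open>A subsolution of the truncated problem for \<epsilon> is one for any larger
      \<delta>, so maximality orders the solutions.\<close>
    have zmono: "z \<epsilon> i \<le> z \<delta> i" if "0 < \<epsilon>" "\<epsilon> \<le> \<delta>" "i \<in> S" for \<epsilon> \<delta> i
    proof (rule zmax)
      show "\<forall>j\<in>S. z \<epsilon> j \<le> G \<delta> (z \<epsilon>) j"
        using zle[OF \<open>0 < \<epsilon>\<close>] \<open>\<epsilon> \<le> \<delta>\<close> by (fastforce simp: G_def)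
    qed (use that in auto)
    define e where "e k = 1 / real (Suc k)" for k
    have e: "e k > 0" "k \<le> k' \<Longrightarrow> e k' \<le> e k" for k k'
      by (auto simp: e_def frac_le)
    have zw: "w i \<le> z (e k) i" if "i \<in> S" for i k
      using w e(1)[of k] that by (intro zmax) (auto simp: G_def)
    define y where "y i = (INF k. z (e k) i)" for i
    have bdd: "bdd_below (range (\<lambda>k. z (e k) i))" if "i \<in> S" for i
      using zw[OF that] by (auto simp: bdd_below_def)
    have ylim: "(\<lambda>k. z (e k) i) \<longlonglongrightarrow> y i" if "i \<in> S" for i
      unfolding y_def using zmono[OF e(1) e(2) that] bdd[OF that]
      by (intro LIMSEQ_decseq_INF) (auto simp: decseq_def)
    \<comment> \<open>Passage to the limit: the distance from \<open>z (e k)\<close> to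
      \<open>y\<close> and the cost increment \<open>e k\<close> each contribute at most half of
      \<epsilon>.\<close>
    have ysub: "y i \<le> T y i" if i: "i \<in> S" for i
    proof (rule field_le_epsilon)
      fix \<epsilon> :: real assume "\<epsilon> > 0"
      have "eventually (\<lambda>k. \<forall>j\<in>S. z (e k) j < y j + \<epsilon> / 2) sequentially"
        using ylim \<open>\<epsilon> > 0\<close> finite_S by (intro eventually_ball_finite ballI order_tendstoD(2)) auto
      moreover have "eventually (\<lambda>k. e k < \<epsilon> / 2) sequentially"
        unfolding e_def using \<open>\<epsilon> > 0\<close> by (intro order_tendstoD(2)[OF LIMSEQ_Suc[OF lim_1_over_n]]) auto
      ultimately have "eventually (\<lambda>k. (\<forall>j\<in>S. z (e k) j < y j + \<epsilon> / 2) \<and> e k < \<epsilon> / 2) sequentially"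
        by eventually_elim auto
      then obtain k where k: "\<And>j. j \<in> S \<Longrightarrow> z (e k) j < y j + \<epsilon> / 2" "e k < \<epsilon> / 2"
        using eventually_happens'[OF sequentially_bot] by blast
      have "y i \<le> z (e k) i" unfolding y_def by (intro cINF_lower bdd[OF i]) auto
      also have "\<dots> \<le> T (z (e k)) i + e k" by (rule zle(2)[OF e(1) i])
      also have "\<dots> \<le> (T y i + \<epsilon> / 2) + \<epsilon> / 2"
        using k \<open>\<epsilon> > 0\<close> by (intro add_mono T_shift[OF i]) (auto intro: less_imp_le)
      finally show "y i \<le> T y i + \<epsilon>" by simp
    qed
    \<comment> \<open>Once the truncation is inactive at a state it stays so for smaller increments.
      If this happened at every state, finiteness of \<open>S\<close> would give a common index,
      contradicting \<open>neg\<close>.\<close>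
    have "\<exists>i\<in>S. \<forall>k. z (e k) i = w i + 1"
    proof (rule ccontr)
      assume none: "\<not> ?thesis"
      have "\<forall>i\<in>S. \<exists>k. z (e k) i < w i + 1"
        using none zle(1)[OF e(1)] by (meson order_le_imp_less_or_eq)
      from bchoice[OF this] obtain k where k: "\<forall>i\<in>S. z (e (k i)) i < w i + 1" ..
      define K where "K = Max (insert 0 (k ` S))"
      have "k i \<le> K" if "i \<in> S" for i unfolding K_def using that finite_S by (intro Max_ge) auto
      then have "\<forall>i\<in>S. z (e K) i < w i + 1"
        using zmono[OF e(1) e(2)] k by (meson order_le_less_trans)
      then show False using neg e(1) by blast
    qed
    then obtain i where i: "i \<in> S" "\<And>k. z (e k) i = w i + 1" by blast
    then have "y i = w i + 1" by (simp add: y_def)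
    with wmax[OF ysub i(1)] show False by simp
  qed
  then obtain \<epsilon> where \<epsilon>: "\<epsilon> > 0" "\<And>i. i \<in> S \<Longrightarrow> z \<epsilon> i < w i + 1" by blast
  \<comment> \<open>Where the truncation is inactive, the fixed point equation reads
    \<open>z = T z + \<epsilon>\<close>, which leaves slack \<epsilon> for every action.\<close>
  have "val (z \<epsilon>) i a + \<epsilon> \<le> z \<epsilon> i" if "i \<in> S" "a \<in> A i" for i a
    using z[OF \<epsilon>(1) that(1)] \<epsilon>(2)[OF that(1)] val_le_T[OF that, of "z \<epsilon>"]
    by (auto simp: G_def min_def split: if_splits)
  then show ?thesis using \<epsilon>(1) by blast
qed

end

section \<open>Limits of probability weights on a finite set\<close>

lemma finite_compactness:
  fixes f :: "nat \<Rightarrow> 'a \<Rightarrow> real"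
  assumes "finite A" and "\<And>k a. a \<in> A \<Longrightarrow> f k a \<in> {0..1}"
  shows "\<exists>r w. strict_mono r \<and> (\<forall>a\<in>A. (\<lambda>k. f (r k) a) \<longlonglongrightarrow> w a)"
  using assms
proof (induction A rule: finite_induct)
  case empty
  show ?case by (auto intro!: exI[of _ id] simp: strict_mono_def)
next
  case (insert a A)
  have "\<exists>r w. strict_mono r \<and> (\<forall>a\<in>A. (\<lambda>k. f (r k) a) \<longlonglongrightarrow> w a)"
    using insert.prems by (intro insert.IH) auto
  then obtain r w where r: "strict_mono r" "\<forall>a\<in>A. (\<lambda>k. f (r k) a) \<longlonglongrightarrow> w a"
    by blast
  \<comment> \<open>One coordinate at a time: passing to a further subsequence for \<open>a\<close>
    preserves the limits already found on \<open>A\<close>.\<close>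
  have "seq_compact {0..1::real}" by (simp add: compact_imp_seq_compact)
  moreover have "\<forall>k. f (r k) a \<in> {0..1}" using insert.prems by auto
  ultimately obtain q b where q: "strict_mono q" "((\<lambda>k. f (r k) a) \<circ> q) \<longlonglongrightarrow> b"
    by (rule seq_compactE)
  have "(\<lambda>k. f ((r \<circ> q) k) x) \<longlonglongrightarrow> (w(a := b)) x" if "x \<in> insert a A" for x
    using that q insert.hyps(2) LIMSEQ_subseq_LIMSEQ[OF r(2)[rule_format] q(1)] by (auto simp: o_def)
  then show ?case using strict_mono_o[OF r(1) q(1)] by blast
qed

lemma pmf_of_finite_weights:
  fixes w :: "'a \<Rightarrow> real"
  assumes "finite A" "\<And>a. a \<in> A \<Longrightarrow> 0 \<le> w a" "(\<Sum>a\<in>A. w a) = 1"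
  obtains \<rho> where "set_pmf \<rho> \<subseteq> A" "\<And>a. a \<in> A \<Longrightarrow> pmf \<rho> a = w a"
proof -
  define f where "f a = (if a \<in> A then w a else 0)" for a
  have "(\<integral>\<^sup>+ a. ennreal (f a) \<partial>count_space UNIV) = (\<Sum>a\<in>A. ennreal (f a))"
    using assms(1) by (intro nn_integral_count_space') (auto simp: f_def)
  also have "\<dots> = ennreal (\<Sum>a\<in>A. w a)"
    using assms(2) by (simp add: f_def sum_ennreal)
  finally have "(\<integral>\<^sup>+ a. ennreal (f a) \<partial>count_space UNIV) = 1" using assms(3) by simp
  then have eq: "pmf (embed_pmf f) a = f a" for a
    using assms(2) by (intro pmf_embed_pmf) (auto simp: f_def)
  show thesis
    by (rule that[of "embed_pmf f"]) (auto simp: eq f_def set_pmf_iff split: if_splits)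
qed

section \<open>The game and its one-step lookahead\<close>

locale ssp_game =
  fixes n :: nat and U :: "nat \<Rightarrow> 'u set" and V :: "nat \<Rightarrow> 'v set"
    and P :: "nat \<Rightarrow> 'u \<Rightarrow> 'v \<Rightarrow> nat pmf" and ghat :: "nat \<Rightarrow> 'u \<Rightarrow> 'v \<Rightarrow> nat \<Rightarrow> real"
  assumes game: "finite_ssp_game n U V P"
begin

abbreviation "S \<equiv> {1..n}"
abbreviation "R \<equiv> Rset n U V"
abbreviation "Q\<^sub>e \<equiv> Qbar U V"

lemma U: "i \<in> S \<Longrightarrow> finite (U i)" "i \<in> S \<Longrightarrow> U i \<noteq> {}"
  and V: "i \<in> S \<Longrightarrow> finite (V i)" "i \<in> S \<Longrightarrow> V i \<noteq> {}"
  and P_supp: "i \<in> S \<Longrightarrow> u \<in> U i \<Longrightarrow> v \<in> V i \<Longrightarrow> set_pmf (P i u v) \<subseteq> {0..n}"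
  using game unfolding finite_ssp_game_def by blast+

lemma finite_R: "finite R"
proof (rule finite_subset)
  show "R \<subseteq> (\<Union>i\<in>S. {i} \<times> U i \<times> V i)" unfolding Rset_def by auto
  show "finite (\<Union>i\<in>S. {i} \<times> U i \<times> V i)" using U V by (intro finite_UN_I finite_cartesian_product) auto
qed

lemma P_sum: "i \<in> S \<Longrightarrow> u \<in> U i \<Longrightarrow> v \<in> V i \<Longrightarrow> (\<Sum>j\<in>{0..n}. pmf (P i u v) j) = 1"
  using P_supp by (intro sum_pmf_eq_1) auto

lemma P_sum_le: "i \<in> S \<Longrightarrow> u \<in> U i \<Longrightarrow> v \<in> V i \<Longrightarrow> (\<Sum>j\<in>S. pmf (P i u v) j) \<le> 1"
  by (subst P_sum[symmetric]) (auto intro!: sum_mono2)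

text \<open>Factoring the Q-factor operator into \<open>minmax_val\<close> followed by
  \<open>lookahead\<close> moves comparisons from Q-factors to functions of the state.\<close>

definition lookahead :: "(nat \<Rightarrow> real) \<Rightarrow> nat \<times> 'u \<times> 'v \<Rightarrow> real" where
  "lookahead x = (\<lambda>(i, u, v). gcost n P ghat i u v + (\<Sum>j\<in>S. pmf (P i u v) j * x j))"

lemma Fop_eq_lookahead: "Fop n U V P ghat Q = lookahead (minmax_val U V Q)"
  by (simp add: Fop_def lookahead_def)

text \<open>The transition mass on \<open>S\<close> is at most 1, the rest going to termination, so
  a nonnegative shift is not amplified.\<close>

lemma lookahead_shift:
  assumes l: "l \<in> R" and r: "r \<ge> 0" and xy: "\<And>j. j \<in> S \<Longrightarrow> x j \<le> y j + r"
  shows "lookahead x l \<le> lookahead y l + r"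
proof -
  obtain i u v where [simp]: "l = (i, u, v)" and l': "i \<in> S" "u \<in> U i" "v \<in> V i"
    using l by (cases l) (auto simp: Rset_def)
  have "(\<Sum>j\<in>S. pmf (P i u v) j * x j) \<le> (\<Sum>j\<in>S. pmf (P i u v) j * (y j + r))"
    by (intro sum_mono mult_left_mono xy) auto
  also have "\<dots> = (\<Sum>j\<in>S. pmf (P i u v) j * y j) + (\<Sum>j\<in>S. pmf (P i u v) j) * r"
    by (simp add: distrib_left sum.distrib sum_distrib_right)
  also have "\<dots> \<le> (\<Sum>j\<in>S. pmf (P i u v) j * y j) + 1 * r"
    using P_sum_le[OF l'] r by (intro add_left_mono mult_right_mono) auto
  finally show ?thesis by (simp add: lookahead_def)
qed

lemma lookahead_mono:
  "l \<in> R \<Longrightarrow> (\<And>j. j \<in> S \<Longrightarrow> x j \<le> y j) \<Longrightarrow> lookahead x l \<le> lookahead y l"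
  using lookahead_shift[of l 0 x y] by simp

subsection \<open>Mixed values of a Q-factor vector\<close>

lemma Qbar_shift:
  assumes s: "s \<in> S" and \<rho>: "set_pmf \<rho> \<subseteq> U s" and \<sigma>: "set_pmf \<sigma> \<subseteq> V s"
    and le: "\<And>l. l \<in> R \<Longrightarrow> X l \<le> Y l + r"
  shows "Q\<^sub>e X s \<rho> \<sigma> \<le> Q\<^sub>e Y s \<rho> \<sigma> + r"
proof -
  have one: "(\<Sum>u\<in>U s. \<Sum>v\<in>V s. pmf \<rho> u * pmf \<sigma> v * r) = r"
    using sum_pmf_eq_1[OF U(1)[OF s] \<rho>] sum_pmf_eq_1[OF V(1)[OF s] \<sigma>]
    by (simp flip: sum_distrib_left sum_distrib_right)
  have "Q\<^sub>e X s \<rho> \<sigma> \<le> (\<Sum>u\<in>U s. \<Sum>v\<in>V s. pmf \<rho> u * pmf \<sigma> v * (Y (s, u, v) + r))"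
    unfolding Qbar_def using s by (intro sum_mono mult_left_mono le) (auto simp: Rset_def)
  also have "\<dots> = Q\<^sub>e Y s \<rho> \<sigma> + r"
    by (simp add: Qbar_def distrib_left sum.distrib one)
  finally show ?thesis .
qed

lemma Qbar_pure1: "s \<in> S \<Longrightarrow> u \<in> U s \<Longrightarrow> Q\<^sub>e X s (return_pmf u) \<sigma> = (\<Sum>v\<in>V s. pmf \<sigma> v * X (s, u, v))"
  using U(1)[of s] unfolding Qbar_def
  by (subst sum.remove[of _ u]) (auto simp: pmf_return intro!: sum.neutral)

lemma Qbar_pure2: "s \<in> S \<Longrightarrow> v \<in> V s \<Longrightarrow> Q\<^sub>e X s \<rho> (return_pmf v) = (\<Sum>u\<in>U s. pmf \<rho> u * X (s, u, v))"
  using V(1)[of s] unfolding Qbar_def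
  by (subst sum.swap, subst sum.remove[of _ v]) (auto simp: pmf_return intro!: sum.neutral)

text \<open>\<open>Q\<^sub>e\<close> is affine in each mixed strategy, so a bound at the pure
  strategies extends to mixtures.\<close>

lemma Qbar_ge_pure:
  assumes s: "s \<in> S" and \<rho>: "set_pmf \<rho> \<subseteq> U s" and le: "\<And>u. u \<in> U s \<Longrightarrow> C \<le> Q\<^sub>e X s (return_pmf u) \<sigma>"
  shows "C \<le> Q\<^sub>e X s \<rho> \<sigma>"
proof -
  have "C = (\<Sum>u\<in>U s. pmf \<rho> u * C)"
    using sum_pmf_eq_1[OF U(1)[OF s] \<rho>] by (simp flip: sum_distrib_right)
  also have "\<dots> \<le> (\<Sum>u\<in>U s. pmf \<rho> u * Q\<^sub>e X s (return_pmf u) \<sigma>)"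
    by (intro sum_mono mult_left_mono le) auto
  also have "\<dots> = Q\<^sub>e X s \<rho> \<sigma>"
    unfolding Qbar_def[of _ _ X s \<rho>] using s
    by (intro sum.cong refl) (simp add: Qbar_pure1 sum_distrib_left mult_ac)
  finally show ?thesis .
qed

lemma Qbar_le_pure:
  assumes s: "s \<in> S" and \<sigma>: "set_pmf \<sigma> \<subseteq> V s" and le: "\<And>v. v \<in> V s \<Longrightarrow> Q\<^sub>e X s \<rho> (return_pmf v) \<le> C"
  shows "Q\<^sub>e X s \<rho> \<sigma> \<le> C"
proof -
  have "Q\<^sub>e X s \<rho> \<sigma> = (\<Sum>v\<in>V s. pmf \<sigma> v * Q\<^sub>e X s \<rho> (return_pmf v))"
    unfolding Qbar_def[of _ _ X s \<rho> \<sigma>] using s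
    by (subst sum.swap, intro sum.cong refl) (simp add: Qbar_pure2 sum_distrib_left mult_ac)
  also have "\<dots> \<le> (\<Sum>v\<in>V s. pmf \<sigma> v * C)"
    by (intro sum_mono mult_left_mono le) auto
  also have "\<dots> = C"
    using sum_pmf_eq_1[OF V(1)[OF s] \<sigma>] by (simp flip: sum_distrib_right)
  finally show ?thesis .
qed

text \<open>Supplies the boundedness under which the real-valued \<open>INF\<close> and
  \<open>SUP\<close> in \<open>minmax_val\<close> are genuine bounds.\<close>

lemma Qbar_bounded:
  assumes s: "s \<in> S"
  obtains B where "\<And>\<rho> \<sigma>. set_pmf \<rho> \<subseteq> U s \<Longrightarrow> set_pmf \<sigma> \<subseteq> V s \<Longrightarrow> \<bar>Q\<^sub>e X s \<rho> \<sigma>\<bar> \<le> B"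
proof -
  have "\<bar>Q\<^sub>e X s \<rho> \<sigma>\<bar> \<le> (\<Sum>u\<in>U s. \<Sum>v\<in>V s. \<bar>X (s, u, v)\<bar>)" for \<rho> \<sigma>
  proof -
    have "\<bar>Q\<^sub>e X s \<rho> \<sigma>\<bar> \<le> (\<Sum>u\<in>U s. \<Sum>v\<in>V s. \<bar>pmf \<rho> u * pmf \<sigma> v * X (s, u, v)\<bar>)"
      unfolding Qbar_def by (rule order_trans[OF sum_abs sum_mono[OF sum_abs]])
    also have "\<dots> \<le> (\<Sum>u\<in>U s. \<Sum>v\<in>V s. \<bar>X (s, u, v)\<bar>)"
      by (intro sum_mono) (simp add: abs_mult mult_left_le_one_le mult_le_one pmf_le_1)
    finally show ?thesis .
  qed
  then show thesis by (rule that)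
qed

text \<open>By affinity the inner supremum is attained at a pure control in the finite set
  \<open>V s\<close>, and the outer infimum is at most its value at the given \<rho>.\<close>

lemma minmax_le_best_response:
  assumes s: "s \<in> S" and \<rho>: "set_pmf \<rho> \<subseteq> U s"
  obtains \<sigma> where "set_pmf \<sigma> \<subseteq> V s" "minmax_val U V X s \<le> Q\<^sub>e X s \<rho> \<sigma>"
proof -
  obtain B where B: "\<And>\<rho> \<sigma>. set_pmf \<rho> \<subseteq> U s \<Longrightarrow> set_pmf \<sigma> \<subseteq> V s \<Longrightarrow> \<bar>Q\<^sub>e X s \<rho> \<sigma>\<bar> \<le> B"
    using Qbar_bounded[OF s] by blast
  obtain v0 where v0: "v0 \<in> V s" using V(2)[OF s] by blast
  define w where "w v = Q\<^sub>e X s \<rho> (return_pmf v)" for v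
  obtain v where v: "v \<in> V s" "w v = Max (w ` V s)"
    using Max_in[of "w ` V s"] V[OF s] by fastforce
  have "minmax_val U V X s \<le> (SUP \<sigma>\<in>{\<sigma>. set_pmf \<sigma> \<subseteq> V s}. Q\<^sub>e X s \<rho> \<sigma>)"
  proof -
    have "bdd_below ((\<lambda>\<rho>. SUP \<sigma>\<in>{\<sigma>. set_pmf \<sigma> \<subseteq> V s}. Q\<^sub>e X s \<rho> \<sigma>) ` {\<rho>. set_pmf \<rho> \<subseteq> U s})"
    proof (rule bdd_belowI2)
      fix \<rho> assume \<rho>: "\<rho> \<in> {\<rho>. set_pmf \<rho> \<subseteq> U s}"
      have "- B \<le> Q\<^sub>e X s \<rho> (return_pmf v0)" using B[of \<rho> "return_pmf v0"] \<rho> v0 by auto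
      also have "\<dots> \<le> (SUP \<sigma>\<in>{\<sigma>. set_pmf \<sigma> \<subseteq> V s}. Q\<^sub>e X s \<rho> \<sigma>)"
        using v0 B \<rho> by (intro cSUP_upper bdd_aboveI2[where M = B]) (auto simp: abs_le_iff)
      finally show "- B \<le> (SUP \<sigma>\<in>{\<sigma>. set_pmf \<sigma> \<subseteq> V s}. Q\<^sub>e X s \<rho> \<sigma>)" .
    qed
    then show ?thesis
      using s \<rho> by (auto simp: minmax_val_def intro!: cINF_lower)
  qed
  also have "\<dots> \<le> Q\<^sub>e X s \<rho> (return_pmf v)"
  proof (rule cSUP_least)
    show "{\<sigma>. set_pmf \<sigma> \<subseteq> V s} \<noteq> {}" using v0 by (auto intro!: exI[of _ "return_pmf v0"])
    show "Q\<^sub>e X s \<rho> \<sigma> \<le> Q\<^sub>e X s \<rho> (return_pmf v)" if "\<sigma> \<in> {\<sigma>. set_pmf \<sigma> \<subseteq> V s}" for \<sigma>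
    proof (rule Qbar_le_pure[OF s])
      show "Q\<^sub>e X s \<rho> (return_pmf v') \<le> Q\<^sub>e X s \<rho> (return_pmf v)" if "v' \<in> V s" for v'
        using v(2) Max_ge[of "w ` V s" "w v'"] V(1)[OF s] that unfolding w_def by simp
    qed (use that in auto)
  qed
  finally show thesis using v(1) by (intro that[of "return_pmf v"]) auto
qed

text \<open>Compactness of the simplex: strategies within \<open>1 / Suc k\<close> of the infimum
  have a subsequence with convergent weights, and the limit weights form a strategy because
  \<open>Q\<^sub>e\<close> and the total mass are continuous in the weights.\<close>

lemma minmax_attained:
  assumes s: "s \<in> S"
  obtains \<rho> where "set_pmf \<rho> \<subseteq> U s" "\<And>\<sigma>. set_pmf \<sigma> \<subseteq> V s \<Longrightarrow> Q\<^sub>e X s \<rho> \<sigma> \<le> minmax_val U V X s"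
proof -
  obtain B where B: "\<And>\<rho> \<sigma>. set_pmf \<rho> \<subseteq> U s \<Longrightarrow> set_pmf \<sigma> \<subseteq> V s \<Longrightarrow> \<bar>Q\<^sub>e X s \<rho> \<sigma>\<bar> \<le> B"
    using Qbar_bounded[OF s] by blast
  obtain u0 where u0: "u0 \<in> U s" using U(2)[OF s] by blast
  let ?m = "minmax_val U V X s" and ?D = "{\<rho>. set_pmf \<rho> \<subseteq> U s}" and ?E = "{\<sigma>. set_pmf \<sigma> \<subseteq> V s}"
  have "\<forall>k. \<exists>\<rho>. \<rho> \<in> ?D \<and> (\<forall>\<sigma>\<in>?E. Q\<^sub>e X s \<rho> \<sigma> \<le> ?m + 1 / Suc k)"
  proof
    fix k :: nat
    have INF: "(INF \<rho>\<in>?D. SUP \<sigma>\<in>?E. Q\<^sub>e X s \<rho> \<sigma>) < ?m + 1 / Suc k"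
      using s by (simp add: minmax_val_def)
    obtain \<rho> where \<rho>: "\<rho> \<in> ?D" "(SUP \<sigma>\<in>?E. Q\<^sub>e X s \<rho> \<sigma>) < ?m + 1 / Suc k"
    proof -
      have "return_pmf u0 \<in> ?D" using u0 by simp
      then have "(\<lambda>\<rho>. SUP \<sigma>\<in>?E. Q\<^sub>e X s \<rho> \<sigma>) ` ?D \<noteq> {}" by blast
      from cInf_lessD[OF this INF] show thesis using that by blast
    qed
    have "Q\<^sub>e X s \<rho> \<sigma> \<le> ?m + 1 / Suc k" if "\<sigma> \<in> ?E" for \<sigma>
    proof -
      have "Q\<^sub>e X s \<rho> \<sigma> \<le> (SUP \<sigma>\<in>?E. Q\<^sub>e X s \<rho> \<sigma>)"
        using that B \<rho>(1) by (intro cSUP_upper bdd_aboveI2[where M = B]) (auto simp: abs_le_iff)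
      then show ?thesis using \<rho>(2) by simp
    qed
    then show "\<exists>\<rho>. \<rho> \<in> ?D \<and> (\<forall>\<sigma>\<in>?E. Q\<^sub>e X s \<rho> \<sigma> \<le> ?m + 1 / Suc k)"
      using \<rho>(1) by (intro exI[of _ \<rho>]) auto
  qed
  from choice[OF this] obtain \<rho> where
    "\<forall>k. \<rho> k \<in> ?D \<and> (\<forall>\<sigma>\<in>?E. Q\<^sub>e X s (\<rho> k) \<sigma> \<le> ?m + 1 / Suc k)" ..
  then have \<rho>: "\<And>k. set_pmf (\<rho> k) \<subseteq> U s"
    "\<And>k \<sigma>. set_pmf \<sigma> \<subseteq> V s \<Longrightarrow> Q\<^sub>e X s (\<rho> k) \<sigma> \<le> ?m + 1 / Suc k"
    by auto
  have "\<exists>r w. strict_mono r \<and> (\<forall>u\<in>U s. (\<lambda>k. pmf (\<rho> (r k)) u) \<longlonglongrightarrow> w u)"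
    using U(1)[OF s] by (intro finite_compactness) (auto simp: pmf_le_1)
  then obtain r w where r: "strict_mono r" and rw: "\<forall>u\<in>U s. (\<lambda>k. pmf (\<rho> (r k)) u) \<longlonglongrightarrow> w u"
    by blast
  have "0 \<le> w u" if "u \<in> U s" for u
    using rw[rule_format, OF that] by (intro LIMSEQ_le_const[of _ "w u" 0]) auto
  moreover have "(\<lambda>k. \<Sum>u\<in>U s. pmf (\<rho> (r k)) u) \<longlonglongrightarrow> (\<Sum>u\<in>U s. w u)"
    using rw by (intro tendsto_sum) auto
  then have "(\<Sum>u\<in>U s. w u) = 1"
    using sum_pmf_eq_1[OF U(1)[OF s] \<rho>(1)] by (simp add: LIMSEQ_const_iff)
  ultimately obtain \<pi> where \<pi>: "set_pmf \<pi> \<subseteq> U s" "\<And>u. u \<in> U s \<Longrightarrow> pmf \<pi> u = w u"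
    using pmf_of_finite_weights[of "U s" w] U(1)[OF s] by blast
  have "Q\<^sub>e X s \<pi> \<sigma> \<le> ?m" if \<sigma>: "set_pmf \<sigma> \<subseteq> V s" for \<sigma>
  proof (rule LIMSEQ_le)
    show "(\<lambda>k. Q\<^sub>e X s (\<rho> (r k)) \<sigma>) \<longlonglongrightarrow> Q\<^sub>e X s \<pi> \<sigma>"
      unfolding Qbar_def using rw \<pi>(2) by (intro tendsto_intros) auto
    have "(\<lambda>k. ?m + 1 / real (Suc k)) \<longlonglongrightarrow> ?m + 0"
      by (intro tendsto_add tendsto_const LIMSEQ_Suc[OF lim_1_over_n])
    then show "(\<lambda>k. ?m + 1 / real (Suc (r k))) \<longlonglongrightarrow> ?m"
      using LIMSEQ_subseq_LIMSEQ[OF _ r] by (fastforce simp: o_def)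
    show "\<exists>N. \<forall>k\<ge>N. Q\<^sub>e X s (\<rho> (r k)) \<sigma> \<le> ?m + 1 / real (Suc (r k))"
      using \<rho>(2)[OF \<sigma>] by blast
  qed
  with \<pi>(1) show thesis by (rule that)
qed

text \<open>A minimizer for \<open>Y\<close> is paired with a best response for \<open>X\<close>, so
  the two values are compared at one common pair of strategies.\<close>

lemma minmax_shift:
  assumes "s \<le> n" "r \<ge> 0" and le: "\<And>l. l \<in> R \<Longrightarrow> X l \<le> Y l + r"
  shows "minmax_val U V X s \<le> minmax_val U V Y s + r"
proof (cases "s = 0")
  case True
  then show ?thesis using assms(2) by (simp add: minmax_val_def)
next
  case False
  then have s: "s \<in> S" using assms(1) by auto
  obtain \<rho> where \<rho>: "set_pmf \<rho> \<subseteq> U s" "\<And>\<sigma>. set_pmf \<sigma> \<subseteq> V s \<Longrightarrow> Q\<^sub>e Y s \<rho> \<sigma> \<le> minmax_val U V Y s"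
    using minmax_attained[OF s] by blast
  obtain \<sigma> where \<sigma>: "set_pmf \<sigma> \<subseteq> V s" "minmax_val U V X s \<le> Q\<^sub>e X s \<rho> \<sigma>"
    using minmax_le_best_response[OF s \<rho>(1)] by blast
  show ?thesis
    using Qbar_shift[OF s \<rho>(1) \<sigma>(1), of X Y r] le \<sigma>(2) \<rho>(2)[OF \<sigma>(1)] by simp
qed

lemma minmax_le:
  assumes s: "s \<in> S" and \<rho>: "set_pmf \<rho> \<subseteq> U s" and le: "\<And>v. v \<in> V s \<Longrightarrow> Q\<^sub>e X s \<rho> (return_pmf v) \<le> C"
  shows "minmax_val U V X s \<le> C"
proof -
  obtain \<sigma> where \<sigma>: "set_pmf \<sigma> \<subseteq> V s" "minmax_val U V X s \<le> Q\<^sub>e X s \<rho> \<sigma>"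
    using minmax_le_best_response[OF s \<rho>] by blast
  then show ?thesis using Qbar_le_pure[OF s \<sigma>(1) le] by simp
qed

text \<open>The attaining strategy of player I does no better against \<sigma> than the best pure
  reply.\<close>

lemma minmax_ge:
  assumes s: "s \<in> S" and \<sigma>: "set_pmf \<sigma> \<subseteq> V s" and le: "\<And>u. u \<in> U s \<Longrightarrow> C \<le> Q\<^sub>e X s (return_pmf u) \<sigma>"
  shows "C \<le> minmax_val U V X s"
proof -
  obtain \<rho> where \<rho>: "set_pmf \<rho> \<subseteq> U s" "\<And>\<sigma>. set_pmf \<sigma> \<subseteq> V s \<Longrightarrow> Q\<^sub>e X s \<rho> \<sigma> \<le> minmax_val U V X s"
    using minmax_attained[OF s] by blast
  show ?thesis using Qbar_ge_pure[OF s \<rho>(1) le] \<rho>(2)[OF \<sigma>] by simp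
qed

subsection \<open>Stationary policies and prolonging pairs\<close>

context
  fixes \<mu> :: "nat \<Rightarrow> 'u pmf" and \<nu> :: "nat \<Rightarrow> 'v pmf"
  assumes \<mu>: "\<mu> \<in> SR1 n U" and \<nu>: "\<nu> \<in> SR2 n V"
begin

lemma \<mu>_supp: "i \<in> S \<Longrightarrow> set_pmf (\<mu> i) \<subseteq> U i" and \<nu>_supp: "i \<in> S \<Longrightarrow> set_pmf (\<nu> i) \<subseteq> V i"
  using \<mu> \<nu> by (auto simp: SR1_def SR2_def)

abbreviation "step \<equiv> sr_step P \<mu> \<nu>"
abbreviation "dist\<^sub>k \<equiv> sr_state_dist P \<mu> \<nu>"
abbreviation "cost \<equiv> sr_stage_cost P ghat \<mu> \<nu>"
abbreviation "E \<equiv> measure_pmf.expectation"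

lemma expectation_bind_controls:
  assumes i: "i \<in> S" and fin: "\<And>u v. u \<in> U i \<Longrightarrow> v \<in> V i \<Longrightarrow> finite (set_pmf (K u v))"
  shows "E (bind_pmf (\<mu> i) (\<lambda>u. bind_pmf (\<nu> i) (K u))) f
    = (\<Sum>u\<in>U i. \<Sum>v\<in>V i. pmf (\<mu> i) u * pmf (\<nu> i) v * (E (K u v) f :: real))"
proof -
  have fin': "finite (set_pmf (bind_pmf (\<nu> i) (K u)))" if "u \<in> U i" for u
    unfolding set_bind_pmf using that fin \<nu>_supp[OF i]
    by (intro finite_UN_I finite_subset[OF \<nu>_supp[OF i] V(1)[OF i]]) auto
  have "E (bind_pmf (\<mu> i) (\<lambda>u. bind_pmf (\<nu> i) (K u))) f
    = (\<Sum>u\<in>U i. pmf (\<mu> i) u *\<^sub>R E (bind_pmf (\<nu> i) (K u)) f)"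
    using U(1)[OF i] \<mu>_supp[OF i] fin' by (intro pmf_expectation_bind) auto
  also have "\<dots> = (\<Sum>u\<in>U i. pmf (\<mu> i) u *\<^sub>R (\<Sum>v\<in>V i. pmf (\<nu> i) v *\<^sub>R E (K u v) f))"
    using V(1)[OF i] \<nu>_supp[OF i] fin
    by (intro sum.cong refl arg_cong2[where f = scaleR] pmf_expectation_bind) auto
  finally show ?thesis by (simp add: sum_distrib_left mult_ac)
qed

lemma expectation_P:
  assumes "i \<in> S" "u \<in> U i" "v \<in> V i"
  shows "E (P i u v) f = (\<Sum>j\<in>{0..n}. pmf (P i u v) j * (f j :: real))"
  using P_supp[OF assms] by (subst integral_measure_pmf_real[of "{0..n}"]) (auto simp: mult.commute)

lemma finite_P: "i \<in> S \<Longrightarrow> u \<in> U i \<Longrightarrow> v \<in> V i \<Longrightarrow> finite (set_pmf (P i u v))"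
  using P_supp[of i u v] by (auto intro: finite_subset)

lemma cost_eq:
  assumes i: "i \<in> S"
  shows "cost i = (\<Sum>u\<in>U i. \<Sum>v\<in>V i. pmf (\<mu> i) u * pmf (\<nu> i) v * gcost n P ghat i u v)"
proof -
  have "cost i = E (bind_pmf (\<mu> i) (\<lambda>u. bind_pmf (\<nu> i) (\<lambda>v.
      bind_pmf (P i u v) (\<lambda>j'. return_pmf (u, v, j'))))) (\<lambda>(u, v, j'). ghat i u v j')"
    using i by (simp add: sr_stage_cost_def)
  also have "\<dots> = (\<Sum>u\<in>U i. \<Sum>v\<in>V i. pmf (\<mu> i) u * pmf (\<nu> i) v *
      E (bind_pmf (P i u v) (\<lambda>j'. return_pmf (u, v, j'))) (\<lambda>(u, v, j'). ghat i u v j'))"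
    using finite_P[OF i] by (intro expectation_bind_controls[OF i]) auto
  also have "\<dots> = (\<Sum>u\<in>U i. \<Sum>v\<in>V i. pmf (\<mu> i) u * pmf (\<nu> i) v * gcost n P ghat i u v)"
  proof (intro sum.cong refl arg_cong2[where f = "(*)"])
    fix u v assume uv: "u \<in> U i" "v \<in> V i"
    show "E (bind_pmf (P i u v) (\<lambda>j'. return_pmf (u, v, j'))) (\<lambda>(u, v, j'). ghat i u v j') = gcost n P ghat i u v"
      using P_supp[OF i uv] by (subst pmf_expectation_bind[of "{0..n}"]) (auto simp: gcost_def)
  qed
  finally show ?thesis .
qed

lemma step_0: "step 0 = return_pmf 0" "cost 0 = 0"
  by (simp_all add: sr_step_def sr_stage_cost_def)

lemma set_step: "j \<le> n \<Longrightarrow> set_pmf (step j) \<subseteq> {0..n}"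
proof (cases "j = 0")
  case False
  assume "j \<le> n"
  with False have j: "j \<in> S" by auto
  show ?thesis
    unfolding sr_step_def using False P_supp[OF j] \<mu>_supp[OF j] \<nu>_supp[OF j] by fastforce
qed (simp add: step_0)

lemma expectation_step:
  assumes j: "j \<in> S"
  shows "E (step j) f = (\<Sum>u\<in>U j. \<Sum>v\<in>V j. pmf (\<mu> j) u * pmf (\<nu> j) v * (\<Sum>k\<in>{0..n}. pmf (P j u v) k * (f k :: real)))"
proof -
  have "E (step j) f = (\<Sum>u\<in>U j. \<Sum>v\<in>V j. pmf (\<mu> j) u * pmf (\<nu> j) v * E (P j u v) f)"
    using j finite_P[OF j] unfolding sr_step_def by (auto intro!: expectation_bind_controls[OF j])
  then show ?thesis using expectation_P[OF j] by simp
qed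

text \<open>Connects the Markov chain of the pair with the finite sums in \<open>Q\<^sub>e\<close>:
  the expected stage cost plus continuation is the policy evaluation operator.\<close>

lemma one_stage:
  assumes i: "i \<in> S"
  shows "cost i + E (step i) (x(0 := 0)) = Q\<^sub>e (lookahead x) i (\<mu> i) (\<nu> i)"
proof -
  have split: "{0..n} = insert 0 S" by auto
  have "(\<Sum>k\<in>{0..n}. pmf (P i u v) k * (x(0 := 0)) k) = (\<Sum>k\<in>S. pmf (P i u v) k * x k)" for u v
    unfolding split by (auto intro!: sum.cong)
  then show ?thesis
    unfolding expectation_step[OF i] cost_eq[OF i] Qbar_def lookahead_def
    by (simp add: distrib_left sum.distrib)
qed

lemma dist_0: "dist\<^sub>k i 0 = return_pmf i"
  by (simp add: sr_state_dist_def)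

lemma dist_Suc: "dist\<^sub>k i (Suc k) = bind_pmf (dist\<^sub>k i k) step"
  by (simp add: sr_state_dist_def)

text \<open>Splitting off the first step instead of the last one shows how survival probabilities,
  as functions of the initial state, change under \<open>step\<close>.\<close>

lemma dist_Suc_left: "dist\<^sub>k i (Suc k) = bind_pmf (step i) (\<lambda>j. dist\<^sub>k j k)"
proof (induction k)
  case 0
  show ?case by (simp add: dist_Suc dist_0 bind_return_pmf bind_return_pmf')
next
  case (Suc k)
  have "dist\<^sub>k i (Suc (Suc k)) = bind_pmf (bind_pmf (step i) (\<lambda>j. dist\<^sub>k j k)) step"
    using Suc by (simp add: dist_Suc)
  then show ?case by (simp add: bind_assoc_pmf dist_Suc)
qed

lemma dist_absorbed: "dist\<^sub>k 0 k = return_pmf 0"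
  by (induction k) (simp_all add: dist_0 dist_Suc bind_return_pmf step_0)

lemma set_dist: "i \<le> n \<Longrightarrow> set_pmf (dist\<^sub>k i k) \<subseteq> {0..n}"
proof (induction k)
  case (Suc k)
  then show ?case using set_step by (fastforce simp: dist_Suc)
qed (simp add: dist_0)

lemma expectation_dist:
  "i \<le> n \<Longrightarrow> E (dist\<^sub>k i k) f = (\<Sum>j\<in>{0..n}. pmf (dist\<^sub>k i k) j * (f j :: real))"
  using set_dist[of i k] by (subst integral_measure_pmf_real[of "{0..n}"]) (auto simp: mult.commute)

lemma expectation_dist_Suc:
  assumes "i \<le> n"
  shows "E (dist\<^sub>k i (Suc k)) f = E (dist\<^sub>k i k) (\<lambda>j. E (step j) f :: real)"
proof -
  have fin: "finite (set_pmf (step j))" if "j \<in> {0..n}" for j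
    using set_step[of j] that by (auto intro: finite_subset)
  have "E (dist\<^sub>k i (Suc k)) f = (\<Sum>j\<in>{0..n}. pmf (dist\<^sub>k i k) j *\<^sub>R E (step j) f)"
    unfolding dist_Suc using set_dist[OF assms] fin by (intro pmf_expectation_bind) auto
  then show ?thesis by (simp add: expectation_dist[OF assms])
qed

lemma expectation_dist_Suc_left:
  assumes "i \<le> n"
  shows "E (dist\<^sub>k i (Suc k)) f = E (step i) (\<lambda>j. E (dist\<^sub>k j k) f :: real)"
proof -
  have fin: "finite (set_pmf (dist\<^sub>k j k))" if "j \<in> {0..n}" for j
    using set_dist[of j k] that by (auto intro: finite_subset)
  have "E (dist\<^sub>k i (Suc k)) f = (\<Sum>j\<in>{0..n}. pmf (step i) j *\<^sub>R E (dist\<^sub>k j k) f)"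
    unfolding dist_Suc_left using set_step[OF assms] fin by (intro pmf_expectation_bind) auto
  also have "\<dots> = E (step i) (\<lambda>j. E (dist\<^sub>k j k) f)"
    using set_step[OF assms] by (subst integral_measure_pmf_real[of "{0..n}"]) (auto simp: mult.commute)
  finally show ?thesis .
qed

lemma expectation_dist_mono:
  "i \<le> n \<Longrightarrow> (\<And>j. j \<le> n \<Longrightarrow> f j \<le> g j) \<Longrightarrow> E (dist\<^sub>k i k) f \<le> (E (dist\<^sub>k i k) g :: real)"
  by (simp add: expectation_dist) (intro sum_mono mult_left_mono, auto)

definition alive :: "nat \<Rightarrow> nat \<Rightarrow> real" where
  "alive k i = measure_pmf.prob (dist\<^sub>k i k) {j. j \<noteq> 0}"

lemma alive_eq: "alive k i = E (dist\<^sub>k i k) (indicator {j. j \<noteq> 0})"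
  by (simp add: alive_def)

lemma alive_simps [simp]: "alive k 0 = 0" "i \<noteq> 0 \<Longrightarrow> alive 0 i = 1"
  by (simp_all add: alive_def dist_absorbed dist_0)

lemma alive_Suc_le:
  assumes "i \<le> n"
  shows "alive (Suc k) i \<le> alive k i"
  unfolding alive_eq expectation_dist_Suc[OF assms]
proof (rule expectation_dist_mono[OF assms])
  fix j
  show "E (step j) (indicator {j. j \<noteq> 0}) \<le> (indicator {j. j \<noteq> 0} j :: real)"
    by (cases "j = 0") (auto simp: step_0)
qed

lemma alive_antimono: "k \<le> k' \<Longrightarrow> i \<le> n \<Longrightarrow> alive k' i \<le> alive k i"
  by (rule lift_Suc_antimono_le) (auto intro: alive_Suc_le)

lemma not_prolonging_alive:
  assumes "\<not> prolonging n P \<mu> \<nu>" "i \<in> S" "e > 0"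
  shows "\<exists>k. alive k i < e"
proof -
  have "(INF k. alive k i) \<le> 0"
    using assms(1,2) by (auto simp: prolonging_def alive_def not_less)
  then have "(INF k. alive k i) < e" using assms(3) by simp
  then show ?thesis using cInf_lessD[of "range (\<lambda>k. alive k i)" e] by auto
qed

text \<open>\<open>Q\<^sub>e (lookahead x) j (\<mu> j) (\<nu> j)\<close> is the policy evaluation operator of the pair applied to \<open>x\<close>;
  \<open>x(0 := 0)\<close> is needed since \<open>lookahead\<close> ignores the value of \<open>x\<close> at the termination state.\<close>

lemma partial_costs:
  assumes i: "i \<in> S"
  shows "(\<Sum>k<t. E (dist\<^sub>k i k) cost) + E (dist\<^sub>k i t) (x(0 := 0)) = x i +
    (\<Sum>k<t. E (dist\<^sub>k i k) (\<lambda>j. if j = 0 then 0 else Q\<^sub>e (lookahead x) j (\<mu> j) (\<nu> j) - x j))"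
proof (induction t)
  case 0
  then show ?case using i by (simp add: dist_0)
next
  case (Suc t)
  have i': "i \<le> n" using i by simp
  \<comment> \<open>Each stage contributes the defect of \<open>x\<close> in the evaluation
    equation; summing these identities telescopes the continuation terms.\<close>
  have eq: "cost j + E (step j) (x(0 := 0)) = (x(0 := 0)) j + (if j = 0 then 0 else Q\<^sub>e (lookahead x) j (\<mu> j) (\<nu> j) - x j)"
    if "j \<le> n" for j
    using that one_stage[of j x] by (cases "j = 0") (auto simp: step_0)
  have "E (dist\<^sub>k i t) cost + E (dist\<^sub>k i (Suc t)) (x(0 := 0))
      = (\<Sum>j\<in>{0..n}. pmf (dist\<^sub>k i t) j * (cost j + E (step j) (x(0 := 0))))"
    by (simp add: expectation_dist_Suc[OF i'] expectation_dist[OF i', of t] distrib_left sum.distrib del: fun_upd_apply)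
  also have "\<dots> = (\<Sum>j\<in>{0..n}. pmf (dist\<^sub>k i t) j *
      ((x(0 := 0)) j + (if j = 0 then 0 else Q\<^sub>e (lookahead x) j (\<mu> j) (\<nu> j) - x j)))"
    using eq by (intro sum.cong refl) (simp del: fun_upd_apply)
  also have "\<dots> = E (dist\<^sub>k i t) (x(0 := 0))
      + E (dist\<^sub>k i t) (\<lambda>j. if j = 0 then 0 else Q\<^sub>e (lookahead x) j (\<mu> j) (\<nu> j) - x j)"
    by (simp add: expectation_dist[OF i', of t] distrib_left sum.distrib del: fun_upd_apply)
  finally show ?case using Suc by (simp del: fun_upd_apply)
qed

text \<open>Only surviving paths contribute, and one constant serves all times and initial states,
  so the terminal term dies out with the survival probability.\<close>

lemma expectation_dist_bounded:
  obtains B where "\<And>i k. i \<le> n \<Longrightarrow> \<bar>E (dist\<^sub>k i k) (x(0 := 0))\<bar> \<le> B * alive k i"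
proof -
  define B where "B = (\<Sum>j\<in>{0..n}. \<bar>x j\<bar>)"
  have "\<bar>E (dist\<^sub>k i k) (x(0 := 0))\<bar> \<le> B * alive k i" if i: "i \<le> n" for i k
  proof -
    have "\<bar>E (dist\<^sub>k i k) (x(0 := 0))\<bar> \<le> (\<Sum>j\<in>{0..n}. \<bar>pmf (dist\<^sub>k i k) j * (x(0 := 0)) j\<bar>)"
      unfolding expectation_dist[OF i] by (rule sum_abs)
    also have "\<dots> \<le> (\<Sum>j\<in>{0..n}. pmf (dist\<^sub>k i k) j * (B * indicator {j. j \<noteq> 0} j))"
    proof (rule sum_mono)
      fix j assume "j \<in> {0..n}"
      then have "\<bar>x j\<bar> \<le> B" unfolding B_def by (intro member_le_sum) auto
      then show "\<bar>pmf (dist\<^sub>k i k) j * (x(0 := 0)) j\<bar> \<le> pmf (dist\<^sub>k i k) j * (B * indicator {j. j \<noteq> 0} j)"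
        by (auto simp: abs_mult intro!: mult_left_mono)
    qed
    also have "\<dots> = B * alive k i"
      unfolding alive_eq expectation_dist[OF i] sum_distrib_left
      by (intro sum.cong refl) (simp add: mult.left_commute)
    finally show ?thesis .
  qed
  then show thesis by (rule that)
qed

lemma alive_le_1: "alive k i \<le> 1"
  by (simp add: alive_def)

lemma alive_nonneg: "0 \<le> alive k i"
  by (simp add: alive_def)

text \<open>For a supersolution all defects in \<open>partial_costs\<close> are nonpositive and the
  terminal term is bounded, so the partial costs are uniformly bounded above.\<close>

lemma supersolution_Jcost:
  assumes sup: "\<And>j. j \<in> S \<Longrightarrow> Q\<^sub>e (lookahead x) j (\<mu> j) (\<nu> j) \<le> x j" and i: "i \<in> S"
  shows "Jcost P ghat i \<mu> \<nu> < \<infinity>"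
proof -
  obtain B where B: "\<And>i k. i \<le> n \<Longrightarrow> \<bar>E (dist\<^sub>k i k) (x(0 := 0))\<bar> \<le> B * alive k i"
    using expectation_dist_bounded by blast
  have i': "i \<le> n" using i by simp
  have le: "(\<Sum>k\<le>t. E (dist\<^sub>k i k) cost) \<le> x i + \<bar>B\<bar>" for t
  proof -
    have "(\<Sum>k<Suc t. E (dist\<^sub>k i k) (\<lambda>j. if j = 0 then 0 else Q\<^sub>e (lookahead x) j (\<mu> j) (\<nu> j) - x j)) \<le> 0"
    proof (rule sum_nonpos)
      fix k
      have "E (dist\<^sub>k i k) (\<lambda>j. if j = 0 then 0 else Q\<^sub>e (lookahead x) j (\<mu> j) (\<nu> j) - x j) \<le> E (dist\<^sub>k i k) (\<lambda>_. 0)"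
        using sup by (intro expectation_dist_mono[OF i']) auto
      then show "E (dist\<^sub>k i k) (\<lambda>j. if j = 0 then 0 else Q\<^sub>e (lookahead x) j (\<mu> j) (\<nu> j) - x j) \<le> 0" by simp
    qed
    moreover have "B * alive (Suc t) i \<le> \<bar>B\<bar>"
      using mult_mono[of B "\<bar>B\<bar>" "alive (Suc t) i" 1] alive_le_1 alive_nonneg by auto
    ultimately show ?thesis
      using partial_costs[OF i, of "Suc t" x] B[OF i', of "Suc t"] by (simp add: lessThan_Suc_atMost)
  qed
  have "Jcost P ghat i \<mu> \<nu> \<le> liminf (\<lambda>_::nat. ereal (x i + \<bar>B\<bar>))"
    unfolding Jcost_def using le by (intro Liminf_mono) auto
  also have "\<dots> < \<infinity>" by (simp add: Liminf_const)
  finally show ?thesis .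
qed

text \<open>The mirror image: nonnegative defects bound the partial costs from below.\<close>

lemma subsolution_Jcost:
  assumes sub: "\<And>j. j \<in> S \<Longrightarrow> x j \<le> Q\<^sub>e (lookahead x) j (\<mu> j) (\<nu> j)" and i: "i \<in> S"
  shows "Jcost P ghat i \<mu> \<nu> > -\<infinity>"
proof -
  obtain B where B: "\<And>i k. i \<le> n \<Longrightarrow> \<bar>E (dist\<^sub>k i k) (x(0 := 0))\<bar> \<le> B * alive k i"
    using expectation_dist_bounded by blast
  have i': "i \<le> n" using i by simp
  have le: "x i - \<bar>B\<bar> \<le> (\<Sum>k\<le>t. E (dist\<^sub>k i k) cost)" for t
  proof -
    have "(\<Sum>k<Suc t. E (dist\<^sub>k i k) (\<lambda>j. if j = 0 then 0 else Q\<^sub>e (lookahead x) j (\<mu> j) (\<nu> j) - x j)) \<ge> 0"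
    proof (rule sum_nonneg)
      fix k
      have "E (dist\<^sub>k i k) (\<lambda>j. if j = 0 then 0 else Q\<^sub>e (lookahead x) j (\<mu> j) (\<nu> j) - x j) \<ge> E (dist\<^sub>k i k) (\<lambda>_. 0)"
        using sub by (intro expectation_dist_mono[OF i']) auto
      then show "E (dist\<^sub>k i k) (\<lambda>j. if j = 0 then 0 else Q\<^sub>e (lookahead x) j (\<mu> j) (\<nu> j) - x j) \<ge> 0" by simp
    qed
    moreover have "B * alive (Suc t) i \<le> \<bar>B\<bar>"
      using mult_mono[of B "\<bar>B\<bar>" "alive (Suc t) i" 1] alive_le_1 alive_nonneg by auto
    ultimately show ?thesis
      using partial_costs[OF i, of "Suc t" x] B[OF i', of "Suc t"] by (simp add: lessThan_Suc_atMost)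
  qed
  have "-\<infinity> < liminf (\<lambda>_::nat. ereal (x i - \<bar>B\<bar>))" by (simp add: Liminf_const)
  also have "\<dots> \<le> Jcost P ghat i \<mu> \<nu>"
    unfolding Jcost_def using le by (intro Liminf_mono) auto
  finally show ?thesis .
qed

text \<open>Subtracting the two instances of \<open>partial_costs\<close> cancels the costs. The
  defects have opposite signs, and the remaining terminal terms are a multiple of the survival
  probability, which becomes arbitrarily small.\<close>

lemma not_prolonging_comparison:
  assumes np: "\<not> prolonging n P \<mu> \<nu>"
    and sup: "\<And>j. j \<in> S \<Longrightarrow> Q\<^sub>e (lookahead x) j (\<mu> j) (\<nu> j) \<le> x j"
    and sub: "\<And>j. j \<in> S \<Longrightarrow> y j \<le> Q\<^sub>e (lookahead y) j (\<mu> j) (\<nu> j)"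
    and i: "i \<in> S"
  shows "y i \<le> x i"
proof (rule field_le_epsilon)
  fix e :: real assume "e > 0"
  have i': "i \<le> n" using i by simp
  obtain Bx where Bx: "\<And>i k. i \<le> n \<Longrightarrow> \<bar>E (dist\<^sub>k i k) (x(0 := 0))\<bar> \<le> Bx * alive k i"
    using expectation_dist_bounded[of x] by blast
  obtain By where By: "\<And>i k. i \<le> n \<Longrightarrow> \<bar>E (dist\<^sub>k i k) (y(0 := 0))\<bar> \<le> By * alive k i"
    using expectation_dist_bounded[of y] by blast
  define B where "B = \<bar>Bx\<bar> + \<bar>By\<bar> + 1"
  obtain t where t: "alive t i < e / B"
    using not_prolonging_alive[OF np i, of "e / B"] \<open>e > 0\<close> by (auto simp: B_def)
  have "(\<Sum>k<t. E (dist\<^sub>k i k) (\<lambda>j. if j = 0 then 0 else Q\<^sub>e (lookahead x) j (\<mu> j) (\<nu> j) - x j))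
    \<le> (\<Sum>k<t. E (dist\<^sub>k i k) (\<lambda>j. if j = 0 then 0 else Q\<^sub>e (lookahead y) j (\<mu> j) (\<nu> j) - y j))"
  proof (intro sum_mono expectation_dist_mono[OF i'])
    fix j assume "j \<le> n"
    then show "(if j = 0 then 0 else Q\<^sub>e (lookahead x) j (\<mu> j) (\<nu> j) - x j)
      \<le> (if j = 0 then 0 else Q\<^sub>e (lookahead y) j (\<mu> j) (\<nu> j) - y j)"
      using sup[of j] sub[of j] by auto
  qed
  then have "y i - x i \<le> E (dist\<^sub>k i t) (y(0 := 0)) - E (dist\<^sub>k i t) (x(0 := 0))"
    using partial_costs[OF i, of t x] partial_costs[OF i, of t y] by simp
  also have "\<dots> \<le> B * alive t i"
  proof -
    have "By * alive t i \<le> \<bar>By\<bar> * alive t i" "Bx * alive t i \<le> \<bar>Bx\<bar> * alive t i"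
      using alive_nonneg by (auto intro: mult_right_mono)
    then show ?thesis
      using Bx[OF i', of t] By[OF i', of t] alive_nonneg[of t i] by (simp add: B_def distrib_right)
  qed
  also have "\<dots> \<le> e"
  proof -
    have "0 < B" by (simp add: B_def)
    then show ?thesis using t by (simp add: pos_less_divide_eq mult.commute)
  qed
  finally show "y i \<le> x i + e" by simp
qed

text \<open>The truncated expected lifetime \<open>h\<close> of a pair that is not prolonging drops by at least
  one half in each step, so its multiples dominate the stage costs.\<close>

lemma not_prolonging_supersolution:
  assumes np: "\<not> prolonging n P \<mu> \<nu>"
  shows "\<exists>x. (\<forall>j\<in>S. Q\<^sub>e (lookahead x) j (\<mu> j) (\<nu> j) \<le> x j) \<and>
    (\<forall>j\<in>S. - x j \<le> Q\<^sub>e (lookahead (\<lambda>j. - x j)) j (\<mu> j) (\<nu> j))"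
proof -
  have "\<forall>i\<in>S. \<exists>k. alive k i < 1/2" by (intro ballI not_prolonging_alive[OF np]) auto
  from bchoice[OF this] obtain K where K: "\<forall>i\<in>S. alive (K i) i < 1/2" ..
  define N where "N = Max (insert 0 (K ` S))"
  have N: "alive N i \<le> 1/2" if "i \<in> S" for i
  proof -
    have "K i \<le> N" unfolding N_def using that by (intro Max_ge) auto
    then show ?thesis using alive_antimono[of "K i" N i] K that by force
  qed
  define h where "h i = (\<Sum>k<N. alive k i)" for i
  have h0: "h(0 := 0) = h" by (auto simp: h_def)
  \<comment> \<open>A step turns \<open>alive k\<close> into \<open>alive (Suc k)\<close>, so the
    sum telescopes: it loses \<open>alive 0 i = 1\<close> and gains \<open>alive N i\<close>, which
    is at most one half.\<close>
  have Eh: "E (step i) h \<le> h i - 1/2" if i: "i \<in> S" for i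
  proof -
    have i': "i \<le> n" "i \<noteq> 0" using i by auto
    have fin: "finite (set_pmf (step i))" using set_step[OF i'(1)] by (auto intro: finite_subset)
    have "E (step i) h = (\<Sum>k<N. E (step i) (\<lambda>j. alive k j))"
      unfolding h_def using fin by (intro Bochner_Integration.integral_sum integrable_measure_pmf_finite) auto
    also have "\<dots> = (\<Sum>k<N. alive (Suc k) i)"
      unfolding alive_eq expectation_dist_Suc_left[OF i'(1)] ..
    also have "\<dots> = h i - alive 0 i + alive N i"
      unfolding h_def by (induction N) auto
    finally show ?thesis using N[OF i] i'(2) by simp
  qed
  define C where "C = (\<Sum>j\<in>S. \<bar>cost j\<bar>)"
  have C: "\<bar>cost j\<bar> \<le> C" if "j \<in> S" for j
    unfolding C_def using that by (intro member_le_sum) auto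
  have "C \<ge> 0" by (simp add: C_def sum_nonneg)
  \<comment> \<open>The factor \<open>2 * C\<close> turns the drop of one half into a drop of
    \<open>C\<close>, which absorbs stage costs of either sign; hence \<open>x\<close> is a
    supersolution and its negative a subsolution.\<close>
  define x where "x j = 2 * C * h j" for j
  have x0: "x(0 := 0) = x" "(\<lambda>j. - x j)(0 := 0) = (\<lambda>j. - x j)" by (auto simp: x_def h_def)
  have Ex: "E (step j) x \<le> x j - C" if "j \<in> S" for j
  proof -
    have "E (step j) x = 2 * C * E (step j) h" by (simp add: x_def[abs_def])
    also have "\<dots> \<le> 2 * C * (h j - 1/2)" using Eh[OF that] \<open>C \<ge> 0\<close> by (intro mult_left_mono) auto
    finally show ?thesis by (simp add: x_def algebra_simps)
  qed
  show ?thesis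
  proof (intro exI[of _ x] conjI ballI)
    fix j assume j: "j \<in> S"
    show "Q\<^sub>e (lookahead x) j (\<mu> j) (\<nu> j) \<le> x j"
      using one_stage[OF j, of x] Ex[OF j] C[OF j] by (simp add: x0)
    show "- x j \<le> Q\<^sub>e (lookahead (\<lambda>j. - x j)) j (\<mu> j) (\<nu> j)"
      using one_stage[OF j, of "\<lambda>j. - x j"] Ex[OF j] C[OF j] by (simp add: x0)
  qed
qed

end

end

subsection \<open>Comparison and strict solutions under the model assumption\<close>

locale ssp_game_model = ssp_game n U V P ghat
  for n :: nat and U :: "nat \<Rightarrow> 'u set" and V :: "nat \<Rightarrow> 'v set"
    and P :: "nat \<Rightarrow> 'u \<Rightarrow> 'v \<Rightarrow> nat pmf" and ghat :: "nat \<Rightarrow> 'u \<Rightarrow> 'v \<Rightarrow> nat \<Rightarrow> real" +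
  assumes model: "ssp_game_assumption n U V P ghat"
begin

lemma prolonging_infinite_cost:
  "\<mu> \<in> SR1 n U \<Longrightarrow> \<nu> \<in> SR2 n V \<Longrightarrow> (\<And>i. i \<in> S \<Longrightarrow> Jcost P ghat i \<mu> \<nu> < \<infinity>) \<Longrightarrow>
    (\<And>i. i \<in> S \<Longrightarrow> Jcost P ghat i \<mu> \<nu> > -\<infinity>) \<Longrightarrow> \<not> prolonging n P \<mu> \<nu>"
  using model unfolding ssp_game_assumption_def by fastforce

text \<open>The supersolution bounds the costs above and the subsolution bounds them below, so (iii)
  excludes a prolonging pair.\<close>

lemma pair_comparison:
  assumes "\<mu> \<in> SR1 n U" "\<nu> \<in> SR2 n V"
    and "\<And>j. j \<in> S \<Longrightarrow> Q\<^sub>e (lookahead x) j (\<mu> j) (\<nu> j) \<le> x j"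
    and "\<And>j. j \<in> S \<Longrightarrow> y j \<le> Q\<^sub>e (lookahead y) j (\<mu> j) (\<nu> j)" and "i \<in> S"
  shows "y i \<le> x i"
  using prolonging_infinite_cost[OF assms(1,2)] supersolution_Jcost[OF assms(1-3)]
    subsolution_Jcost[OF assms(1,2,4)] not_prolonging_comparison[OF assms(1,2) _ assms(3-5)]
  by blast

text \<open>One pair serves both sides: \<mu> attains the value of \<open>X\<close> at each state,
  and \<nu> is a best response to \<mu> for \<open>Y\<close>. The state values of \<open>X\<close>
  and \<open>Y\<close> are then a supersolution and a subsolution for this pair.\<close>

lemma Fop_comparison:
  assumes X: "\<And>l. l \<in> R \<Longrightarrow> Fop n U V P ghat X l \<le> X l"
    and Y: "\<And>l. l \<in> R \<Longrightarrow> Y l \<le> Fop n U V P ghat Y l" and l: "l \<in> R"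
  shows "Y l \<le> X l"
proof -
  define x where "x = minmax_val U V X"
  define y where "y = minmax_val U V Y"
  have "\<forall>s\<in>S. \<exists>\<rho>. set_pmf \<rho> \<subseteq> U s \<and> (\<forall>\<sigma>. set_pmf \<sigma> \<subseteq> V s \<longrightarrow> Q\<^sub>e X s \<rho> \<sigma> \<le> x s)"
  proof
    fix s assume "s \<in> S"
    then obtain \<rho> where "set_pmf \<rho> \<subseteq> U s" "\<And>\<sigma>. set_pmf \<sigma> \<subseteq> V s \<Longrightarrow> Q\<^sub>e X s \<rho> \<sigma> \<le> x s"
      using minmax_attained unfolding x_def by blast
    then show "\<exists>\<rho>. set_pmf \<rho> \<subseteq> U s \<and> (\<forall>\<sigma>. set_pmf \<sigma> \<subseteq> V s \<longrightarrow> Q\<^sub>e X s \<rho> \<sigma> \<le> x s)"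
      by blast
  qed
  from bchoice[OF this] obtain \<mu> where
    \<mu>: "\<forall>s\<in>S. set_pmf (\<mu> s) \<subseteq> U s \<and> (\<forall>\<sigma>. set_pmf \<sigma> \<subseteq> V s \<longrightarrow> Q\<^sub>e X s (\<mu> s) \<sigma> \<le> x s)" ..
  have "\<forall>s\<in>S. \<exists>\<sigma>. set_pmf \<sigma> \<subseteq> V s \<and> y s \<le> Q\<^sub>e Y s (\<mu> s) \<sigma>"
  proof
    fix s assume s: "s \<in> S"
    then have "set_pmf (\<mu> s) \<subseteq> U s" using \<mu> by blast
    then obtain \<sigma> where "set_pmf \<sigma> \<subseteq> V s" "y s \<le> Q\<^sub>e Y s (\<mu> s) \<sigma>"
      using minmax_le_best_response[OF s] unfolding y_def by blast
    then show "\<exists>\<sigma>. set_pmf \<sigma> \<subseteq> V s \<and> y s \<le> Q\<^sub>e Y s (\<mu> s) \<sigma>"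
      by blast
  qed
  from bchoice[OF this] obtain \<nu> where
    \<nu>: "\<forall>s\<in>S. set_pmf (\<nu> s) \<subseteq> V s \<and> y s \<le> Q\<^sub>e Y s (\<mu> s) (\<nu> s)" ..
  have "y j \<le> x j" if j: "j \<in> S" for j
  proof (rule pair_comparison[OF _ _ _ _ j])
    show "\<mu> \<in> SR1 n U" "\<nu> \<in> SR2 n V" using \<mu> \<nu> by (auto simp: SR1_def SR2_def)
    fix s assume s: "s \<in> S"
    have supp: "set_pmf (\<mu> s) \<subseteq> U s" "set_pmf (\<nu> s) \<subseteq> V s" using \<mu> \<nu> s by auto
    have "Q\<^sub>e (lookahead x) s (\<mu> s) (\<nu> s) \<le> Q\<^sub>e X s (\<mu> s) (\<nu> s) + 0"
      using X by (intro Qbar_shift[OF s supp]) (simp add: Fop_eq_lookahead x_def)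
    also have "\<dots> \<le> x s" using \<mu> s supp by simp
    finally show "Q\<^sub>e (lookahead x) s (\<mu> s) (\<nu> s) \<le> x s" .
    have "y s \<le> Q\<^sub>e Y s (\<mu> s) (\<nu> s)" using \<nu> s by simp
    also have "\<dots> \<le> Q\<^sub>e (lookahead y) s (\<mu> s) (\<nu> s) + 0"
      using Y by (intro Qbar_shift[OF s supp]) (simp add: Fop_eq_lookahead y_def)
    finally show "y s \<le> Q\<^sub>e (lookahead y) s (\<mu> s) (\<nu> s)" by simp
  qed
  \<comment> \<open>Returns from states to Q-factors along Y \<le> F Y \<le> F X \<le> X.\<close>
  then have "lookahead y l \<le> lookahead x l" by (intro lookahead_mono[OF l])
  then show ?thesis
    using X[OF l] Y[OF l] by (simp add: Fop_eq_lookahead x_def y_def)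
qed

text \<open>Player I is fixed to the policy of (i), leaving player II a Markov decision problem. Its
  strict supersolution on states lifts to Q-factors because using a fixed \<mu> can only
  overestimate the infimum over player I's strategies.\<close>

lemma strict_supersolution:
  obtains Z where "\<And>l. l \<in> R \<Longrightarrow> Fop n U V P ghat Z l < Z l"
proof -
  obtain \<mu> where \<mu>: "\<mu> \<in> SR1 n U" "\<And>\<nu> i. \<nu> \<in> SR2 n V \<Longrightarrow> i \<in> S \<Longrightarrow> Jcost P ghat i \<mu> \<nu> < \<infinity>"
    using model unfolding ssp_game_assumption_def by blast
  obtain \<nu> where \<nu>: "\<nu> \<in> SR2 n V" "\<And>\<mu> i. \<mu> \<in> SR1 n U \<Longrightarrow> i \<in> S \<Longrightarrow> Jcost P ghat i \<mu> \<nu> > -\<infinity>"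
    using model unfolding ssp_game_assumption_def by blast
  have \<mu>s: "set_pmf (\<mu> i) \<subseteq> U i" and \<nu>s: "set_pmf (\<nu> i) \<subseteq> V i" if "i \<in> S" for i
    using \<mu>(1) \<nu>(1) that unfolding SR1_def SR2_def by blast+
  interpret mdp: finite_mdp S V "\<lambda>y i v. Q\<^sub>e (lookahead y) i (\<mu> i) (return_pmf v)"
    using V \<mu>s by unfold_locales (auto intro!: Qbar_shift lookahead_shift)
  \<comment> \<open>The policies of (i) and (ii) played against each other have costs that are
    nowhere infinite, so the pair supplies an initial subsolution \<open>- x\<close>.\<close>
  have "\<not> prolonging n P \<mu> \<nu>"
    using \<mu> \<nu> by (intro prolonging_infinite_cost) auto
  from not_prolonging_supersolution[OF \<mu>(1) \<nu>(1) this]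
  obtain x where x: "\<forall>j\<in>S. - x j \<le> Q\<^sub>e (lookahead (\<lambda>j. - x j)) j (\<mu> j) (\<nu> j)"
    by (elim exE conjE)
  have "\<exists>z \<epsilon>. \<epsilon> > 0 \<and> (\<forall>i\<in>S. \<forall>v\<in>V i. Q\<^sub>e (lookahead z) i (\<mu> i) (return_pmf v) + \<epsilon> \<le> z i)"
  proof (rule mdp.strict_supersolution[where ?y0.0 = "\<lambda>j. - x j"])
    fix i assume i: "i \<in> S"
    have "Q\<^sub>e (lookahead (\<lambda>j. - x j)) i (\<mu> i) (\<nu> i) \<le> mdp.T (\<lambda>j. - x j) i"
      using mdp.val_le_T[OF i, of _ "\<lambda>j. - x j"] by (intro Qbar_le_pure[OF i \<nu>s[OF i]]) auto
    then show "- x i \<le> mdp.T (\<lambda>j. - x j) i" using bspec[OF x i] by simp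
  next
    fix d assume d: "d \<in> Pi\<^sub>E S V"
    let ?\<nu> = "\<lambda>i. return_pmf (d i)"
    have d2: "?\<nu> \<in> SR2 n V" using d by (auto simp: SR2_def)
    \<comment> \<open>For a rule without subsolutions the bound is vacuous. Otherwise one
      subsolution together with (i) excludes prolonging, and the supersolution \<open>w\<close>
      obtained from this dominates every subsolution.\<close>
    show "\<exists>B. \<forall>y. (\<forall>i\<in>S. y i \<le> Q\<^sub>e (lookahead y) i (\<mu> i) (?\<nu> i)) \<longrightarrow> (\<forall>i\<in>S. y i \<le> B)"
    proof (cases "\<exists>y. \<forall>i\<in>S. y i \<le> Q\<^sub>e (lookahead y) i (\<mu> i) (?\<nu> i)")
      case True
      then obtain y where y: "\<forall>i\<in>S. y i \<le> Q\<^sub>e (lookahead y) i (\<mu> i) (?\<nu> i)" by (elim exE)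
      then have "\<not> prolonging n P \<mu> ?\<nu>"
        by (intro prolonging_infinite_cost[OF \<mu>(1) d2] subsolution_Jcost[OF \<mu>(1) d2, of y] \<mu>(2)[OF d2])
          auto
      from not_prolonging_supersolution[OF \<mu>(1) d2 this]
      obtain w where w: "\<forall>j\<in>S. Q\<^sub>e (lookahead w) j (\<mu> j) (?\<nu> j) \<le> w j"
        by (elim exE conjE)
      have "y i \<le> Max (w ` S)" if "\<forall>i\<in>S. y i \<le> Q\<^sub>e (lookahead y) i (\<mu> i) (?\<nu> i)" "i \<in> S" for y i
      proof -
        have "y i \<le> w i" by (rule pair_comparison[OF \<mu>(1) d2 bspec[OF w] bspec[OF that(1)] that(2)])
        also have "\<dots> \<le> Max (w ` S)" using that by (intro Max_ge) auto
        finally show ?thesis .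
      qed
      then show ?thesis by blast
    qed blast
  qed
  then obtain z \<epsilon> where \<epsilon>: "\<epsilon> > 0"
    and z: "\<And>i v. i \<in> S \<Longrightarrow> v \<in> V i \<Longrightarrow> Q\<^sub>e (lookahead z) i (\<mu> i) (return_pmf v) + \<epsilon> \<le> z i"
    by blast
  \<comment> \<open>The slack is split: averaging \<open>Z\<close> under \<mu> stays below
    \<open>z\<close> thanks to the decision problem, while \<open>Z\<close> exceeds
    \<open>lookahead z\<close> by \<epsilon>.\<close>
  define Z where "Z l = lookahead z l + \<epsilon>" for l
  have "minmax_val U V Z i \<le> z i" if i: "i \<in> S" for i
  proof (rule minmax_le[OF i \<mu>s[OF i]])
    fix v assume v: "v \<in> V i"
    have "Q\<^sub>e Z i (\<mu> i) (return_pmf v) \<le> Q\<^sub>e (lookahead z) i (\<mu> i) (return_pmf v) + \<epsilon>"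
      using v by (intro Qbar_shift[OF i \<mu>s[OF i]]) (auto simp: Z_def)
    then show "Q\<^sub>e Z i (\<mu> i) (return_pmf v) \<le> z i" using z[OF i v] by simp
  qed
  then have "Fop n U V P ghat Z l < Z l" if "l \<in> R" for l
    using lookahead_mono[OF that, of "minmax_val U V Z" z] \<epsilon> by (simp add: Fop_eq_lookahead Z_def)
  then show thesis by (rule that)
qed

text \<open>The mirror argument against the policy of (ii). Values are negated so that the
  minimization of player I becomes a maximizing decision problem.\<close>

lemma strict_subsolution:
  obtains Z where "\<And>l. l \<in> R \<Longrightarrow> Z l < Fop n U V P ghat Z l"
proof -
  obtain \<mu> where \<mu>: "\<mu> \<in> SR1 n U" "\<And>\<nu> i. \<nu> \<in> SR2 n V \<Longrightarrow> i \<in> S \<Longrightarrow> Jcost P ghat i \<mu> \<nu> < \<infinity>"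
    using model unfolding ssp_game_assumption_def by blast
  obtain \<nu> where \<nu>: "\<nu> \<in> SR2 n V" "\<And>\<mu> i. \<mu> \<in> SR1 n U \<Longrightarrow> i \<in> S \<Longrightarrow> Jcost P ghat i \<mu> \<nu> > -\<infinity>"
    using model unfolding ssp_game_assumption_def by blast
  have \<mu>s: "set_pmf (\<mu> i) \<subseteq> U i" and \<nu>s: "set_pmf (\<nu> i) \<subseteq> V i" if "i \<in> S" for i
    using \<mu>(1) \<nu>(1) that unfolding SR1_def SR2_def by blast+
  interpret mdp: finite_mdp S U "\<lambda>y i u. - Q\<^sub>e (lookahead (\<lambda>j. - y j)) i (return_pmf u) (\<nu> i)"
  proof
    show "finite S" by simp
    show "finite (U i) \<and> U i \<noteq> {}" if "i \<in> S" for i using U that by blast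
    fix x y :: "nat \<Rightarrow> real" and r i u
    assume i: "i \<in> S" and u: "u \<in> U i" and r: "r \<ge> 0" and le: "\<And>j. j \<in> S \<Longrightarrow> x j \<le> y j + r"
    have "Q\<^sub>e (lookahead (\<lambda>j. - y j)) i (return_pmf u) (\<nu> i) \<le> Q\<^sub>e (lookahead (\<lambda>j. - x j)) i (return_pmf u) (\<nu> i) + r"
      using u le by (intro Qbar_shift[OF i _ \<nu>s[OF i]] lookahead_shift r) (auto simp: algebra_simps)
    then show "- Q\<^sub>e (lookahead (\<lambda>j. - x j)) i (return_pmf u) (\<nu> i) \<le> - Q\<^sub>e (lookahead (\<lambda>j. - y j)) i (return_pmf u) (\<nu> i) + r"
      by simp
  qed
  have "\<not> prolonging n P \<mu> \<nu>"
    using \<mu> \<nu> by (intro prolonging_infinite_cost) auto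
  from not_prolonging_supersolution[OF \<mu>(1) \<nu>(1) this]
  obtain x where x: "\<forall>j\<in>S. Q\<^sub>e (lookahead x) j (\<mu> j) (\<nu> j) \<le> x j"
    by (elim exE conjE)
  have "\<exists>z \<epsilon>. \<epsilon> > 0 \<and> (\<forall>i\<in>S. \<forall>u\<in>U i. - Q\<^sub>e (lookahead (\<lambda>j. - z j)) i (return_pmf u) (\<nu> i) + \<epsilon> \<le> z i)"
  proof (rule mdp.strict_supersolution[where ?y0.0 = "\<lambda>j. - x j"])
    fix i assume i: "i \<in> S"
    have "- mdp.T (\<lambda>j. - x j) i \<le> Q\<^sub>e (lookahead x) i (\<mu> i) (\<nu> i)"
      using mdp.val_le_T[OF i, of _ "\<lambda>j. - x j"] by (intro Qbar_ge_pure[OF i \<mu>s[OF i]]) force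
    then show "- x i \<le> mdp.T (\<lambda>j. - x j) i" using bspec[OF x i] by simp
  next
    fix d assume d: "d \<in> Pi\<^sub>E S U"
    let ?\<mu> = "\<lambda>i. return_pmf (d i)"
    have d1: "?\<mu> \<in> SR1 n U" using d by (auto simp: SR1_def)
    show "\<exists>B. \<forall>y. (\<forall>i\<in>S. y i \<le> - Q\<^sub>e (lookahead (\<lambda>j. - y j)) i (?\<mu> i) (\<nu> i)) \<longrightarrow> (\<forall>i\<in>S. y i \<le> B)"
    proof (cases "\<exists>y. \<forall>i\<in>S. y i \<le> - Q\<^sub>e (lookahead (\<lambda>j. - y j)) i (?\<mu> i) (\<nu> i)")
      case True
      then obtain y where y: "\<forall>i\<in>S. y i \<le> - Q\<^sub>e (lookahead (\<lambda>j. - y j)) i (?\<mu> i) (\<nu> i)" by blast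
      have "Q\<^sub>e (lookahead (\<lambda>j. - y j)) i (?\<mu> i) (\<nu> i) \<le> - y i" if "i \<in> S" for i
        using y that by force
      then have "\<not> prolonging n P ?\<mu> \<nu>"
        by (intro prolonging_infinite_cost[OF d1 \<nu>(1)] supersolution_Jcost[OF d1 \<nu>(1), of "\<lambda>j. - y j"]
            \<nu>(2)[OF d1])
      from not_prolonging_supersolution[OF d1 \<nu>(1) this]
      obtain w where w: "\<forall>j\<in>S. - w j \<le> Q\<^sub>e (lookahead (\<lambda>j. - w j)) j (?\<mu> j) (\<nu> j)"
        by (elim exE conjE)
      have "y i \<le> Max (w ` S)" if y: "\<forall>i\<in>S. y i \<le> - Q\<^sub>e (lookahead (\<lambda>j. - y j)) i (?\<mu> i) (\<nu> i)" and i: "i \<in> S" for y i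
      proof -
        have "Q\<^sub>e (lookahead (\<lambda>j. - y j)) i (?\<mu> i) (\<nu> i) \<le> - y i" if "i \<in> S" for i
          using y that by force
        then have "- w i \<le> - y i" by (rule pair_comparison[OF d1 \<nu>(1) _ bspec[OF w] i])
        moreover have "w i \<le> Max (w ` S)" using i by (intro Max_ge) auto
        ultimately show ?thesis by simp
      qed
      then show ?thesis by blast
    qed blast
  qed
  then obtain z' \<epsilon> where \<epsilon>: "\<epsilon> > 0"
    and z': "\<forall>i\<in>S. \<forall>u\<in>U i. - Q\<^sub>e (lookahead (\<lambda>j. - z' j)) i (return_pmf u) (\<nu> i) + \<epsilon> \<le> z' i"
    by blast
  define z where "z j = - z' j" for j
  have z: "z i + \<epsilon> \<le> Q\<^sub>e (lookahead z) i (return_pmf u) (\<nu> i)" if "i \<in> S" "u \<in> U i" for i u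
    using z'[rule_format, OF that] unfolding z_def[abs_def] by simp
  define Z where "Z l = lookahead z l - \<epsilon>" for l
  have "z i \<le> minmax_val U V Z i" if i: "i \<in> S" for i
  proof (rule minmax_ge[OF i \<nu>s[OF i]])
    fix u assume u: "u \<in> U i"
    have "Q\<^sub>e (lookahead z) i (return_pmf u) (\<nu> i) \<le> Q\<^sub>e Z i (return_pmf u) (\<nu> i) + \<epsilon>"
      using u by (intro Qbar_shift[OF i _ \<nu>s[OF i]]) (auto simp: Z_def)
    then show "z i \<le> Q\<^sub>e Z i (return_pmf u) (\<nu> i)" using z[OF i u] by simp
  qed
  then have "Z l < Fop n U V P ghat Z l" if "l \<in> R" for l
    using lookahead_mono[OF that, of z "minmax_val U V Z"] \<epsilon> by (simp add: Fop_eq_lookahead Z_def)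
  then show thesis by (rule that)
qed

text \<open>The iteration and its negative yield eventual bounds \<open>u\<close> above and
  \<open>q\<close> below with u \<le> F u and F q \<le> q. Comparison forces u \<le> q, which
  squeezes the path onto \<open>q\<close>.\<close>

lemma sample_path_convergence:
  fixes x :: "nat \<Rightarrow> nat \<times> 'u \<times> 'v \<Rightarrow> real"
  assumes \<gamma>: "\<And>t l. l \<in> R \<Longrightarrow> 0 \<le> \<gamma> t l \<and> \<gamma> t l \<le> 1"
    and \<tau>: "\<And>t l l'. l \<in> R \<Longrightarrow> l' \<in> R \<Longrightarrow> \<tau> t l l' \<le> t"
      "\<And>l l'. l \<in> R \<Longrightarrow> l' \<in> R \<Longrightarrow> filterlim (\<lambda>t. \<tau> t l l') at_top sequentially"
    and js: "\<And>t l. l \<in> R \<Longrightarrow> js t l \<le> n"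
    and iter: "\<And>t i u v. (i, u, v) \<in> R \<Longrightarrow> x (Suc t) (i, u, v) =
      (1 - \<gamma> t (i, u, v)) * x t (i, u, v) + \<gamma> t (i, u, v) * (ghat i u v (js t (i, u, v))
        + minmax_val U V (\<lambda>l'. x (\<tau> t (i, u, v) l') l') (js t (i, u, v)))"
    and avg: "\<And>i u v f T b. (i, u, v) \<in> R \<Longrightarrow>
      (\<And>t. t \<ge> T \<Longrightarrow> b (Suc t) = (1 - \<gamma> t (i, u, v)) * b t + \<gamma> t (i, u, v) * f (js t (i, u, v))) \<Longrightarrow>
      b \<longlonglongrightarrow> (\<Sum>s\<le>n. pmf (P i u v) s * f s)"
  shows "\<exists>q. is_fixpoint_F n U V P ghat q \<and> (\<forall>l\<in>R. (\<lambda>t. x t l) \<longlonglongrightarrow> q l)"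
proof -
  define c where "c = (\<lambda>(i, u, v). ghat i u v)"
  define p where "p = (\<lambda>(i, u, v). pmf (P i u v))"
  interpret up: async_iteration R n "minmax_val U V" c p x \<gamma> \<tau> js
  proof
    show "minmax_val U V y s \<le> minmax_val U V z s + r"
      if "r \<ge> 0" "s \<le> n" "\<And>l. l \<in> R \<Longrightarrow> y l \<le> z l + r" for y z r s
      using that by (intro minmax_shift) auto
    show "b \<longlonglongrightarrow> (\<Sum>s\<le>n. p l s * f s)"
      if "l \<in> R" "\<And>t. T \<le> t \<Longrightarrow> b (Suc t) = (1 - \<gamma> t l) * b t + \<gamma> t l * f (js t l)" for l f T b
      using that avg[of "fst l" "fst (snd l)" "snd (snd l)" T b f] by (simp add: p_def case_prod_beta)
    show "x (Suc t) l = (1 - \<gamma> t l) * x t l + \<gamma> t l * (c l (js t l) + minmax_val U V (\<lambda>l'. x (\<tau> t l l') l') (js t l))"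
      if "l \<in> R" for t l
      using that iter[of "fst l" "fst (snd l)" "snd (snd l)" t] by (simp add: c_def case_prod_beta)
  qed (use finite_R \<gamma> \<tau> js in auto)
  interpret lo: async_iteration R n "\<lambda>y s. - minmax_val U V (\<lambda>l. - y l) s" "\<lambda>l s. - c l s" p "\<lambda>t l. - x t l" \<gamma> \<tau> js
  proof
    show "- minmax_val U V (\<lambda>l. - y l) s \<le> - minmax_val U V (\<lambda>l. - z l) s + r"
      if "r \<ge> 0" "s \<le> n" "\<And>l. l \<in> R \<Longrightarrow> y l \<le> z l + r" for y z r s
    proof -
      have "minmax_val U V (\<lambda>l. - z l) s \<le> minmax_val U V (\<lambda>l. - y l) s + r"
        using that(3) by (intro minmax_shift that(1,2)) (simp add: algebra_simps)
      then show ?thesis by simp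
    qed
    show "- x (Suc t) l = (1 - \<gamma> t l) * - x t l
        + \<gamma> t l * (- c l (js t l) + - minmax_val U V (\<lambda>l'. - (- x (\<tau> t l l') l')) (js t l))"
      if "l \<in> R" for t l
      unfolding up.iter[OF that] by (simp add: algebra_simps)
    show "b \<longlonglongrightarrow> (\<Sum>s\<le>n. p l s * f s)"
      if "l \<in> R" "\<And>t. T \<le> t \<Longrightarrow> b (Suc t) = (1 - \<gamma> t l) * b t + \<gamma> t l * f (js t l)" for l f T b
      using that by (rule up.avg)
  qed (fact up.finite_R up.\<gamma> up.\<tau>_le up.\<tau>_lim up.js)+
  \<comment> \<open>Successor 0 keeps its transition cost, which is part of \<open>gcost\<close>,
    but contributes no continuation value as \<open>minmax_val\<close> is 0 there.\<close>
  have range: "{..n} = insert 0 S" by auto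
  have up_op: "up.op y l = Fop n U V P ghat y l" if "l \<in> R" for y l
  proof -
    have "(\<Sum>s\<le>n. p l s * minmax_val U V y s) = (\<Sum>s\<in>S. p l s * minmax_val U V y s)"
      unfolding range by (simp add: minmax_val_def)
    then show ?thesis
      unfolding up.op_def
      by (cases l) (simp add: Fop_def gcost_def c_def p_def distrib_left sum.distrib atMost_atLeast0)
  qed
  have lo_op: "lo.op y l = - Fop n U V P ghat (\<lambda>l. - y l) l" if "l \<in> R" for y l
    unfolding up_op[OF that, symmetric] lo.op_def up.op_def sum_negf[symmetric]
    by (intro sum.cong refl) (simp add: algebra_simps)
  obtain Z where Z: "\<And>l. l \<in> R \<Longrightarrow> Fop n U V P ghat Z l < Z l" using strict_supersolution by blast
  have "\<exists>B. \<forall>t. \<forall>l\<in>R. x t l \<le> B" by (rule up.bounded_above[of Z]) (simp add: Z up_op)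
  then obtain B where B: "\<And>t l. l \<in> R \<Longrightarrow> x t l \<le> B" by blast
  obtain Z' where Z': "\<And>l. l \<in> R \<Longrightarrow> Z' l < Fop n U V P ghat Z' l" using strict_subsolution by blast
  have "\<exists>A. \<forall>t. \<forall>l\<in>R. - x t l \<le> A" by (rule lo.bounded_above[of "\<lambda>l. - Z' l"]) (simp add: Z' lo_op)
  then obtain A where A: "\<And>t l. l \<in> R \<Longrightarrow> - x t l \<le> A" by blast
  have A': "- A \<le> x t l" if "l \<in> R" for t l using A[OF that, of t] by simp
  have "\<exists>u. (\<forall>l\<in>R. \<forall>r>0. eventually (\<lambda>t. x t l \<le> u l + r) sequentially) \<and> (\<forall>l\<in>R. u l \<le> up.op u l)"
    by (rule up.limsup_subsolution) (fact B A')+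
  then obtain u where "\<forall>l\<in>R. \<forall>r>0. eventually (\<lambda>t. x t l \<le> u l + r) sequentially"
    and u_sub: "\<forall>l\<in>R. u l \<le> up.op u l" by (elim exE conjE)
  then have u: "eventually (\<lambda>t. x t l \<le> u l + r) sequentially" if "l \<in> R" "r > 0" for l r
    using that by blast
  have B': "- B \<le> - x t l" if "l \<in> R" for t l using B[OF that, of t] by simp
  have "\<exists>w. (\<forall>l\<in>R. \<forall>r>0. eventually (\<lambda>t. - x t l \<le> w l + r) sequentially) \<and> (\<forall>l\<in>R. w l \<le> lo.op w l)"
    by (rule lo.limsup_subsolution) (fact A B')+
  then obtain w where "\<forall>l\<in>R. \<forall>r>0. eventually (\<lambda>t. - x t l \<le> w l + r) sequentially"
    and w_sub: "\<forall>l\<in>R. w l \<le> lo.op w l" by (elim exE conjE)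
  then have w: "eventually (\<lambda>t. - x t l \<le> w l + r) sequentially" if "l \<in> R" "r > 0" for l r
    using that by blast
  define q where "q l = - w l" for l
  have q_sup: "Fop n U V P ghat q l \<le> q l" if "l \<in> R" for l
    using bspec[OF w_sub that] lo_op[OF that, of w] by (simp add: q_def[abs_def])
  have u_sub': "u l \<le> Fop n U V P ghat u l" if "l \<in> R" for l
    using bspec[OF u_sub that] up_op[OF that] by simp
  have uq: "u l \<le> q l" if "l \<in> R" for l
    by (rule Fop_comparison[OF q_sup u_sub' that])
  have conv: "(\<lambda>t. x t l) \<longlonglongrightarrow> q l" if l: "l \<in> R" for l
  proof (rule LIMSEQ_I)
    fix e :: real assume "e > 0"
    then have "e / 2 > 0" by simp
    from u[OF l this] w[OF l this]
    have "eventually (\<lambda>t. norm (x t l - q l) < e) sequentially"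
      by eventually_elim (use uq[OF l] \<open>e > 0\<close> in \<open>auto simp: q_def abs_less_iff\<close>)
    then show "\<exists>no. \<forall>t\<ge>no. norm (x t l - q l) < e" by (simp add: eventually_sequentially)
  qed
  \<comment> \<open>The reverse inequality closes the chain q \<le> u \<le> F u \<le> F q \<le> q,
    making the limit a fixed point.\<close>
  have qu: "q l \<le> u l" if l: "l \<in> R" for l
  proof (rule field_le_epsilon)
    fix e :: real assume "e > 0"
    show "q l \<le> u l + e"
      by (rule tendsto_upperbound[OF conv[OF l] u[OF l \<open>e > 0\<close>]]) simp
  qed
  have "Fop n U V P ghat q l = q l" if l: "l \<in> R" for l
  proof (rule antisym[OF q_sup[OF l]])
    have "Fop n U V P ghat u l \<le> Fop n U V P ghat q l"
      unfolding Fop_eq_lookahead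
    proof (rule lookahead_mono[OF l])
      fix j assume "j \<in> S"
      then show "minmax_val U V u j \<le> minmax_val U V q j"
        using minmax_shift[of j 0 u q] uq by simp
    qed
    then show "q l \<le> Fop n U V P ghat q l" using qu[OF l] u_sub'[OF l] by simp
  qed
  then show ?thesis using conv unfolding is_fixpoint_F_def by blast
qed

end

subsection \<open>Convergence of Q-learning\<close>

text \<open>The deviation of \<open>f (js k)\<close> from the mean is a finite combination of
  indicator deviations, so convergence of their weighted series suffices for every \<open>f\<close>
  at once.\<close>

lemma empirical_average:
  fixes \<gamma> :: "nat \<Rightarrow> real" and js :: "nat \<Rightarrow> nat"
  assumes \<gamma>: "\<And>t. 0 \<le> \<gamma> t \<and> \<gamma> t \<le> 1"
    and div: "filterlim (\<lambda>T. \<Sum>t<T. \<gamma> t) at_top sequentially"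
    and js: "\<And>t. js t \<le> n"
    and conv: "\<And>s. s \<le> n \<Longrightarrow> convergent (\<lambda>N. \<Sum>k<N. \<gamma> k * (of_bool (js k = s) - p s))"
    and rec: "\<And>t. t \<ge> T \<Longrightarrow> b (Suc t) = (1 - \<gamma> t) * b t + \<gamma> t * f (js t)"
  shows "b \<longlonglongrightarrow> (\<Sum>s\<le>n. p s * f s)"
proof -
  define a where "a = (\<Sum>s\<le>n. p s * f s)"
  have f: "f (js k) - a = (\<Sum>s\<le>n. f s * (of_bool (js k = s) - p s))" for k
  proof -
    have "(\<Sum>s\<le>n. f s * of_bool (js k = s)) = f (js k)"
      using js[of k] by (subst sum.remove[of _ "js k"]) (auto intro!: sum.neutral)
    then show ?thesis by (simp add: a_def right_diff_distrib sum_subtractf mult.commute)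
  qed
  have "(\<lambda>t. b t - a) \<longlonglongrightarrow> 0"
  proof (rule averaging_tendsto_zero_series[OF \<gamma> div])
    have "convergent (\<lambda>N. \<Sum>s\<le>n. f s * (\<Sum>k<N. \<gamma> k * (of_bool (js k = s) - p s)))"
      using conv by (intro convergent_sum convergent_mult convergent_const) auto
    moreover have "(\<Sum>s\<le>n. f s * (\<Sum>k<N. \<gamma> k * (of_bool (js k = s) - p s))) = (\<Sum>k<N. \<gamma> k * (f (js k) - a))" for N
      unfolding f sum_distrib_left by (subst sum.swap) (simp add: mult.left_commute)
    ultimately show "convergent (\<lambda>N. \<Sum>k<N. \<gamma> k * (f (js k) - a))" by simp
    show "b (Suc t) - a = (1 - \<gamma> t) * (b t - a) + \<gamma> t * (f (js t) - a)" if "t \<ge> T" for t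
      using rec[OF that] by (simp add: algebra_simps)
  qed
  then have "(\<lambda>t. b t - a + a) \<longlonglongrightarrow> 0 + a" by (intro tendsto_add tendsto_const)
  then show ?thesis by (simp add: a_def)
qed

text \<open>Indicator minus conditional probability is a martingale difference bounded by 1, and the
  stepsizes are predictable multipliers with summable squares.\<close>

lemma sampled_successor_series:
  fixes \<gamma> :: "nat \<Rightarrow> 'a \<Rightarrow> real" and js :: "nat \<Rightarrow> 'a \<Rightarrow> nat" and q :: real
  assumes M: "prob_space M" and filt: "filtration (space M) F" and sub: "\<And>t. subalgebra M (F t)"
    and range: "\<And>t \<omega>. \<omega> \<in> space M \<Longrightarrow> 0 \<le> \<gamma> t \<omega> \<and> \<gamma> t \<omega> \<le> 1"
    and \<gamma>: "\<And>t. \<gamma> t \<in> borel_measurable (F t)"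
    and js: "\<And>t. js t \<in> measurable (F (Suc t)) (count_space UNIV)"
    and q: "0 \<le> q" "q \<le> 1"
    and cond: "\<And>t. AE \<omega> in M. real_cond_exp M (F t) (indicator {\<omega>' \<in> space M. js t \<omega>' = s}) \<omega> = q"
    and sq: "AE \<omega> in M. summable (\<lambda>t. (\<gamma> t \<omega>)\<^sup>2)"
  shows "AE \<omega> in M. convergent (\<lambda>N. \<Sum>k<N. \<gamma> k \<omega> * (of_bool (js k \<omega> = s) - q))"
proof -
  interpret prob_space M by (rule M)
  define ind where "ind t = (indicator {\<omega>' \<in> space M. js t \<omega>' = s} :: 'a \<Rightarrow> real)" for t
  have ind_meas: "ind t \<in> borel_measurable (F (Suc t))" for t
  proof -
    have "{\<omega>' \<in> space (F (Suc t)). js t \<omega>' = s} \<in> sets (F (Suc t))"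
      using measurable_sets[OF js, of "{s}" t] by (simp add: vimage_def Int_def conj_commute)
    then show ?thesis
      unfolding ind_def filtration.space_F[OF filt] by (rule borel_measurable_indicator)
  qed
  interpret mg: martingale_difference M F "\<lambda>t \<omega>. ind t \<omega> - q"
  proof
    show "(\<lambda>\<omega>. ind t \<omega> - q) \<in> borel_measurable (F (Suc t))" for t
      using ind_meas by simp
    show "\<bar>ind t \<omega> - q\<bar> \<le> 1" for t \<omega> using q by (auto simp: ind_def indicator_def)
    fix t
    interpret FS: finite_measure_subalgebra M "F t" by unfold_locales (rule sub)
    have "ind t \<in> borel_measurable M" using measurable_from_subalg[OF sub ind_meas] .
    then have int: "integrable M (ind t)"
      by (intro integrable_const_bound[where B = 1]) (auto simp: ind_def indicator_def)
    have "AE \<omega> in M. real_cond_exp M (F t) (\<lambda>\<omega>. ind t \<omega> - q) \<omega>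
        = real_cond_exp M (F t) (ind t) \<omega> - real_cond_exp M (F t) (\<lambda>_. q) \<omega>"
      using int by (intro FS.real_cond_exp_diff) auto
    moreover have "AE \<omega> in M. real_cond_exp M (F t) (\<lambda>_. q) \<omega> = q"
      by (rule FS.real_cond_exp_F_meas) auto
    ultimately show "AE \<omega> in M. real_cond_exp M (F t) (\<lambda>\<omega>. ind t \<omega> - q) \<omega> = 0"
      using cond[of t, folded ind_def] by eventually_elim simp
  qed (fact filtration.space_F[OF filt], fact filtration.sets_F_mono[OF filt], fact sub)
  have "AE \<omega> in M. convergent (\<lambda>N. \<Sum>k<N. \<gamma> k \<omega> * (ind k \<omega> - q))"
    using range by (intro mg.transform_convergent_square_summable \<gamma> sq) auto
  then show ?thesis
  proof (rule AE_mp, intro AE_I2 impI)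
    fix \<omega> assume "\<omega> \<in> space M" and c: "convergent (\<lambda>N. \<Sum>k<N. \<gamma> k \<omega> * (ind k \<omega> - q))"
    then have "ind k \<omega> = of_bool (js k \<omega> = s)" for k by (auto simp: ind_def)
    with c show "convergent (\<lambda>N. \<Sum>k<N. \<gamma> k \<omega> * (of_bool (js k \<omega> = s) - q))" by simp
  qed
qed

theorem theorem3p2:
  fixes n :: nat
    and U :: "nat \<Rightarrow> 'u set" and V :: "nat \<Rightarrow> 'v set"
    and P :: "nat \<Rightarrow> 'u \<Rightarrow> 'v \<Rightarrow> nat pmf"
    and ghat :: "nat \<Rightarrow> 'u \<Rightarrow> 'v \<Rightarrow> nat \<Rightarrow> real"
    and M :: "'a measure" and F :: "nat \<Rightarrow> 'a measure"
    and Q :: "nat \<Rightarrow> 'a \<Rightarrow> nat \<times> 'u \<times> 'v \<Rightarrow> real"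
    and \<gamma> :: "nat \<Rightarrow> nat \<times> 'u \<times> 'v \<Rightarrow> 'a \<Rightarrow> real"
    and \<tau> :: "nat \<Rightarrow> nat \<times> 'u \<times> 'v \<Rightarrow> nat \<times> 'u \<times> 'v \<Rightarrow> 'a \<Rightarrow> nat"
    and js :: "nat \<Rightarrow> nat \<times> 'u \<times> 'v \<Rightarrow> 'a \<Rightarrow> nat"
  assumes game: "finite_ssp_game n U V P"
    and model_assumption: "ssp_game_assumption n U V P ghat"
    and prob: "prob_space M"
    and filt: "filtration (space M) F"
    and sub: "\<And>t. subalgebra M (F t)"
    and gamma_range: "\<And>t l \<omega>. l \<in> Rset n U V \<Longrightarrow> \<omega> \<in> space M \<Longrightarrow> 0 \<le> \<gamma> t l \<omega> \<and> \<gamma> t l \<omega> \<le> 1"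
    and tau_range: "\<And>t l l' \<omega>. l \<in> Rset n U V \<Longrightarrow> l' \<in> Rset n U V \<Longrightarrow> \<omega> \<in> space M \<Longrightarrow>
                      \<tau> t l l' \<omega> \<le> t"
    and succ_range: "\<And>t l \<omega>. l \<in> Rset n U V \<Longrightarrow> \<omega> \<in> space M \<Longrightarrow> js t l \<omega> \<in> {0..n}"
    and iteration: "\<And>t \<omega> i u v. (i, u, v) \<in> Rset n U V \<Longrightarrow> \<omega> \<in> space M \<Longrightarrow>
        Q (Suc t) \<omega> (i, u, v) =
          (1 - \<gamma> t (i, u, v) \<omega>) * Q t \<omega> (i, u, v)
          + \<gamma> t (i, u, v) \<omega> *
              (ghat i u v (js t (i, u, v) \<omega>)
               + minmax_val U V (\<lambda>l'. Q (\<tau> t (i, u, v) l' \<omega>) \<omega> l') (js t (i, u, v) \<omega>))"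
    and cond_i: "\<And>l. l \<in> Rset n U V \<Longrightarrow> (\<lambda>\<omega>. Q 0 \<omega> l) \<in> borel_measurable (F 0)"
    and cond_ii_gamma: "\<And>t l. l \<in> Rset n U V \<Longrightarrow> \<gamma> t l \<in> borel_measurable (F t)"
    and cond_ii_tau: "\<And>t l l'. l \<in> Rset n U V \<Longrightarrow> l' \<in> Rset n U V \<Longrightarrow>
                        \<tau> t l l' \<in> measurable (F t) (count_space UNIV)"
    and cond_iii_meas: "\<And>t l. l \<in> Rset n U V \<Longrightarrow> js t l \<in> measurable (F (Suc t)) (count_space UNIV)"
    and cond_iii_prob: "\<And>t i u v j. (i, u, v) \<in> Rset n U V \<Longrightarrow>
        AE \<omega> in M. real_cond_exp M (F t)
                       (indicator {\<omega>' \<in> space M. js t (i, u, v) \<omega>' = j}) \<omega> = pmf (P i u v) j"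
    and cond_iv: "AE \<omega> in M. \<forall>l\<in>Rset n U V. \<forall>l'\<in>Rset n U V.
                     filterlim (\<lambda>t. \<tau> t l l' \<omega>) at_top sequentially"
    and cond_v: "AE \<omega> in M. \<forall>l\<in>Rset n U V.
                    filterlim (\<lambda>T. \<Sum>t<T. \<gamma> t l \<omega>) at_top sequentially
                    \<and> summable (\<lambda>t. (\<gamma> t l \<omega>)\<^sup>2)"
  shows "\<exists>Qstar. is_fixpoint_F n U V P ghat Qstar
           \<and> (\<forall>Q'. is_fixpoint_F n U V P ghat Q' \<longrightarrow> (\<forall>l\<in>Rset n U V. Q' l = Qstar l))
           \<and> (AE \<omega> in M. \<forall>l\<in>Rset n U V. (\<lambda>t. Q t \<omega> l) \<longlonglongrightarrow> Qstar l)"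
proof -
  interpret ssp_game_model n U V P ghat
    by unfold_locales (fact game, fact model_assumption)
  interpret prob_space M by (rule prob)
  \<comment> \<open>Finitely many triples and successors allow one null set for all of them; it
    depends on no function \<open>f\<close>, starting time or initial value.\<close>
  have conv: "AE \<omega> in M. \<forall>l\<in>R. \<forall>s\<in>{..n}. convergent (\<lambda>N. \<Sum>k<N. \<gamma> k l \<omega> * (of_bool (js k l \<omega> = s)
      - (case l of (i, u, v) \<Rightarrow> pmf (P i u v) s)))"
  proof (intro AE_finite_allI finite_R)
    fix l s assume l: "l \<in> R"
    obtain i u v where luv: "l = (i, u, v)" by (cases l)
    show "AE \<omega> in M. convergent (\<lambda>N. \<Sum>k<N. \<gamma> k l \<omega> * (of_bool (js k l \<omega> = s)
      - (case l of (i, u, v) \<Rightarrow> pmf (P i u v) s)))"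
    proof (rule sampled_successor_series[OF prob filt sub])
      show "AE \<omega> in M. summable (\<lambda>t. (\<gamma> t l \<omega>)\<^sup>2)"
        using cond_v by eventually_elim (use l in auto)
      show "AE \<omega> in M. real_cond_exp M (F t) (indicator {\<omega>' \<in> space M. js t l \<omega>' = s}) \<omega>
          = (case l of (i, u, v) \<Rightarrow> pmf (P i u v) s)" for t
        using cond_iii_prob[of i u v t s] l by (simp add: luv)
    qed (use l gamma_range cond_ii_gamma cond_iii_meas in \<open>auto simp: luv pmf_le_1\<close>)
  qed simp
  have ae: "AE \<omega> in M. \<exists>q. is_fixpoint_F n U V P ghat q \<and> (\<forall>l\<in>R. (\<lambda>t. Q t \<omega> l) \<longlonglongrightarrow> q l)"
    using cond_iv cond_v conv AE_space
  proof eventually_elim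
    case (elim \<omega>)
    show ?case
    proof (rule sample_path_convergence[where \<gamma> = "\<lambda>t l. \<gamma> t l \<omega>" and \<tau> = "\<lambda>t l l'. \<tau> t l l' \<omega>"
          and js = "\<lambda>t l. js t l \<omega>"])
      show "b \<longlonglongrightarrow> (\<Sum>s\<le>n. pmf (P i u v) s * f s)"
        if R: "(i, u, v) \<in> R" and rec: "\<And>t. T \<le> t \<Longrightarrow>
          b (Suc t) = (1 - \<gamma> t (i, u, v) \<omega>) * b t + \<gamma> t (i, u, v) \<omega> * f (js t (i, u, v) \<omega>)"
        for i u v f T b
      proof (rule empirical_average)
        show "filterlim (\<lambda>T. \<Sum>t<T. \<gamma> t (i, u, v) \<omega>) at_top sequentially" using elim(2) R by blast
        show "js t (i, u, v) \<omega> \<le> n" for t using succ_range[OF R elim(4), of t] by simp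
        show "0 \<le> \<gamma> t (i, u, v) \<omega> \<and> \<gamma> t (i, u, v) \<omega> \<le> 1" for t using gamma_range[OF R elim(4)] .
        show "convergent (\<lambda>N. \<Sum>k<N. \<gamma> k (i, u, v) \<omega> * (of_bool (js k (i, u, v) \<omega> = s) - pmf (P i u v) s))"
          if "s \<le> n" for s
          using bspec[OF bspec[OF elim(3) R], of s] that by simp
      qed (rule rec)
      show "js t l \<omega> \<le> n" if "l \<in> R" for t l using succ_range[OF that elim(4), of t] by simp
      show "filterlim (\<lambda>t. \<tau> t l l' \<omega>) at_top sequentially" if "l \<in> R" "l' \<in> R" for l l'
        using elim(1) that by blast
    qed (use gamma_range tau_range iteration elim(4) in auto)
  qed
  \<comment> \<open>Existence of a fixed point comes from the algorithm: an almost sure event in a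
    probability space is nonempty, and any path in it converges to a fixed point.\<close>
  have "\<exists>\<omega>. \<exists>q. is_fixpoint_F n U V P ghat q \<and> (\<forall>l\<in>R. (\<lambda>t. Q t \<omega> l) \<longlonglongrightarrow> q l)"
    using eventually_happens[OF ae] ae_filter_eq_bot_iff[of M] emeasure_space_1 by auto
  then obtain Qstar where fixp: "is_fixpoint_F n U V P ghat Qstar" by blast
  have unique: "q l = Qstar l" if "is_fixpoint_F n U V P ghat q" "l \<in> R" for q l
    using that fixp Fop_comparison[of q Qstar l] Fop_comparison[of Qstar q l]
    by (auto simp: is_fixpoint_F_def intro: antisym)
  \<comment> \<open>A priori the limit depends on the path; uniqueness identifies all these limits
    on \<open>R\<close>.\<close>
  have "AE \<omega> in M. \<forall>l\<in>R. (\<lambda>t. Q t \<omega> l) \<longlonglongrightarrow> Qstar l"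
    using ae by eventually_elim (use unique in auto)
  with fixp unique show ?thesis by blast
qed

end
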